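(* Let $L\ge 3$, $W=(\mathbb{Z}/2\mathbb{Z})^{*L}$ with generating set $S$, $q\in(0,1]$, $h=\sum_{s\in S}T_s$ and $\mathbf{B}=\{h\}''\subseteq\mathrm{VN}_q(W)$ (the radial algebra). Then $\mathbf{B}$ is a maximal abelian von Neumann subalgebra of $\mathrm{VN}_q(W)$.
   Context: $W=(\mathbb{Z}/2\mathbb{Z})^{*L}$ is the free product of $L$ copies of $\mathbb{Z}/2\mathbb{Z}$; $S$ is the set of the $L$ canonical generators, $|\cdot|$ is word length with respect to $S$. Put $p=\frac{q-1}{q^2}$. $\mathbb{C}_q[W]$ is the $*$-algebra with linear basis $\{T_w: w\in W\}$, $T_e=1$, $T_w^*=T_{w^{-1}}$, and for $s\in S$, $w\in W$: $T_sT_w=T_{sw}$ if $|sw|>|w|$, $T_sT_w=T_{sw}+pT_w$ if $|sw|<|w|$. Identifying $T_w$ with $\delta_w\in\ell^2(W)$, left multiplication extends to bounded operators on $\ell^2(W)$, and $\mathrm{VN}_q(W)$ is the von Neumann algebra generated by them in $B(\ell^2(W))$. *)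

theory Defs
  imports "HOL-Analysis.Analysis" "HOL-Library.Function_Algebras"
begin

text \<open>The group W = free product of L copies of Z/2Z, realised as reduced words:
  lists of letters in {0..<L} with no two consecutive equal letters.
  Word length |w| is the list length.\<close>

definition Wgrp :: "nat \<Rightarrow> nat list set" where
  "Wgrp L = {w. set w \<subseteq> {0..<L} \<and> (\<forall>i. Suc i < length w \<longrightarrow> w ! i \<noteq> w ! Suc i)}"

definition gmul :: "nat \<Rightarrow> nat list \<Rightarrow> nat list" where
  "gmul s w = (case w of [] \<Rightarrow> [s] | t # w' \<Rightarrow> (if t = s then w' else s # w))"

definition hp :: "real \<Rightarrow> real" where
  "hp q = (q - 1) / q\<^sup>2"

definition l2 :: "nat \<Rightarrow> (nat list \<Rightarrow> complex) set" where
  "l2 L = {f. (\<forall>v. v \<notin> Wgrp L \<longrightarrow> f v = 0) \<and> (\<lambda>v. (cmod (f v))\<^sup>2) summable_on UNIV}"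

definition l2norm :: "(nat list \<Rightarrow> complex) \<Rightarrow> real" where
  "l2norm f = sqrt (\<Sum>\<^sub>\<infinity>v. (cmod (f v))\<^sup>2)"

text \<open>Bounded linear operators on l^2(W).  An operator is represented by a function on
  all of (nat list => complex) which is required to vanish outside l^2, so that each
  element of B(l^2(W)) has a unique representative.\<close>
definition bdd_op :: "nat \<Rightarrow> ((nat list \<Rightarrow> complex) \<Rightarrow> (nat list \<Rightarrow> complex)) \<Rightarrow> bool" where
  "bdd_op L A \<longleftrightarrow>
     (\<forall>f. f \<notin> l2 L \<longrightarrow> A f = 0) \<and>
     (\<forall>f\<in>l2 L. A f \<in> l2 L) \<and>
     (\<forall>f\<in>l2 L. \<forall>g\<in>l2 L. A (f + g) = A f + A g) \<and>
     (\<forall>f\<in>l2 L. \<forall>c::complex. A (\<lambda>v. c * f v) = (\<lambda>v. c * A f v)) \<and>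
     (\<exists>C. \<forall>f\<in>l2 L. l2norm (A f) \<le> C * l2norm f)"

definition commutant :: "nat \<Rightarrow> ((nat list \<Rightarrow> complex) \<Rightarrow> (nat list \<Rightarrow> complex)) set
    \<Rightarrow> ((nat list \<Rightarrow> complex) \<Rightarrow> (nat list \<Rightarrow> complex)) set" where
  "commutant L X = {A. bdd_op L A \<and> (\<forall>x\<in>X. A \<circ> x = x \<circ> A)}"

definition Id_op :: "nat \<Rightarrow> (nat list \<Rightarrow> complex) \<Rightarrow> (nat list \<Rightarrow> complex)" where
  "Id_op L f = (if f \<in> l2 L then f else 0)"

text \<open>Left multiplication by T_s on l^2(W): T_s delta_w = delta_{sw} if |sw| > |w| and
  T_s delta_w = delta_{sw} + p delta_w if |sw| < |w|; hence
  (T_s xi)(v) = xi(sv) + [|sv| < |v|] p xi(v).\<close>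
definition Ts :: "nat \<Rightarrow> real \<Rightarrow> nat \<Rightarrow> (nat list \<Rightarrow> complex) \<Rightarrow> (nat list \<Rightarrow> complex)" where
  "Ts L q s f = (if f \<in> l2 L then
       (\<lambda>v. if v \<in> Wgrp L then
               f (gmul s v) + (if length (gmul s v) < length v then complex_of_real (hp q) * f v else 0)
             else 0)
     else 0)"

text \<open>Left multiplication by T_w for w = s_1 ... s_n reduced: T_w = T_{s_1} ... T_{s_n}
  (this follows from the multiplication rule since |s_1 ... s_n| = n).\<close>
definition Tw :: "nat \<Rightarrow> real \<Rightarrow> nat list \<Rightarrow> (nat list \<Rightarrow> complex) \<Rightarrow> (nat list \<Rightarrow> complex)" where
  "Tw L q w = foldr (\<lambda>s A. Ts L q s \<circ> A) w (Id_op L)"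

text \<open>VN_q(W): the von Neumann algebra generated by the (adjoint-closed) set of the T_w,
  i.e. its bicommutant.\<close>
definition VNq :: "nat \<Rightarrow> real \<Rightarrow> ((nat list \<Rightarrow> complex) \<Rightarrow> (nat list \<Rightarrow> complex)) set" where
  "VNq L q = commutant L (commutant L (Tw L q ` Wgrp L))"

definition hrad :: "nat \<Rightarrow> real \<Rightarrow> (nat list \<Rightarrow> complex) \<Rightarrow> (nat list \<Rightarrow> complex)" where
  "hrad L q = (\<Sum>s<L. Ts L q s)"

definition Brad :: "nat \<Rightarrow> real \<Rightarrow> ((nat list \<Rightarrow> complex) \<Rightarrow> (nat list \<Rightarrow> complex)) set" where
  "Brad L q = commutant L (commutant L {hrad L q})"

definition masa :: "('a \<Rightarrow> 'a) set \<Rightarrow> ('a \<Rightarrow> 'a) set \<Rightarrow> bool" where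
  "masa B M \<longleftrightarrow> B \<subseteq> M \<and> (\<forall>a\<in>B. \<forall>b\<in>B. a \<circ> b = b \<circ> a) \<and>
     (\<forall>x\<in>M. (\<forall>b\<in>B. x \<circ> b = b \<circ> x) \<longrightarrow> x \<in> B)"

end

(*
  The h-commutation of a vector xi in l^2(W) does not see q: both sum_s T_s xi and sum_s xi T_s
  contain the term p xi(v) exactly once at every v different from e. So if x in VN_q(W) commutes
  with h, then xi = x delta_e satisfies sum_s xi(sv) = sum_s xi(vs).

  For a reduced word u let F(j,k) be the sum of xi over the reduced words x u y with |x| = j and
  |y| = k. Then G(j,k) = F(j+1,k) - F(j,k+1) obeys G(j+1,k+1) = (L-1) G(j,k), while
  square-summability forces G(n,n+k) = o((L-1)^n) for differences of two words u of equal length;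
  so these differences vanish, and xi is radial by induction on |u|.

  Hence xi is a limit of A_n delta_e with A_n in the algebra of h. Both A_n and x commute with
  right multiplications, so A_n - x tends to 0 strongly on finitely supported vectors, and weakly
  on all vectors because its matrix entries are translates of those in the column delta_e.
  This is enough to conclude x y = y x for every y commuting with h.
*)

theory Submission
  imports Defs
begin

subsection \<open>Reduced words\<close>

lemma Wgrp_altdef: "Wgrp L = {w. set w \<subseteq> {0..<L} \<and> distinct_adj w}"
  by (auto simp: Wgrp_def distinct_adj_conv_nth less_diff_conv)

lemma Nil_in_Wgrp [simp]: "[] \<in> Wgrp L"
  by (simp add: Wgrp_altdef)

lemma Cons_in_Wgrp_iff:
  "s # v \<in> Wgrp L \<longleftrightarrow> s < L \<and> v \<in> Wgrp L \<and> (v = [] \<or> s \<noteq> hd v)"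
  by (auto simp: Wgrp_altdef distinct_adj_Cons split: list.splits)

lemma rev_in_Wgrp_iff [simp]: "rev v \<in> Wgrp L \<longleftrightarrow> v \<in> Wgrp L"
  by (simp add: Wgrp_altdef)

lemma append_in_WgrpD: "x @ y \<in> Wgrp L \<Longrightarrow> x \<in> Wgrp L" "x @ y \<in> Wgrp L \<Longrightarrow> y \<in> Wgrp L"
  by (auto simp: Wgrp_altdef distinct_adj_append_iff)

lemma finite_Wgrp_length: "finite {w \<in> Wgrp L. length w = n}"
  by (rule finite_subset[OF _ finite_lists_length_eq[of "{0..<L}" n]]) (auto simp: Wgrp_def)

lemma gmul_Nil [simp]: "gmul s [] = [s]"
  and gmul_Cons: "gmul s (t # v) = (if t = s then v else s # t # v)"
  by (auto simp: gmul_def)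

lemma gmul_in_Wgrp: "v \<in> Wgrp L \<Longrightarrow> s < L \<Longrightarrow> gmul s v \<in> Wgrp L"
  by (cases v) (auto simp: gmul_Cons Cons_in_Wgrp_iff)

lemma gmul_gmul: "v \<in> Wgrp L \<Longrightarrow> gmul s (gmul s v) = v"
  by (cases v; cases "tl v") (auto simp: gmul_Cons Cons_in_Wgrp_iff)

lemma length_gmul_less_iff: "length (gmul s v) < length v \<longleftrightarrow> v \<noteq> [] \<and> hd v = s"
  by (cases v) (auto simp: gmul_Cons)

text \<open>The generators are involutions, so inversion in the group is reversal of words, and v s
  is the inverse of s v^-1.\<close>

definition gmulr :: "nat \<Rightarrow> nat list \<Rightarrow> nat list" where
  "gmulr s v = rev (gmul s (rev v))"

lemma gmulr_Nil [simp]: "gmulr s [] = [s]"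
  and gmulr_snoc: "gmulr s (v @ [t]) = (if t = s then v else v @ [t, s])"
  by (auto simp: gmulr_def gmul_Cons)

text \<open>Associativity of the group. The two factors can meet only in words with at most one
  letter; in longer words the two ends do not interact.\<close>

lemma gmul_gmulr_commute:
  assumes "v \<in> Wgrp L"
  shows "gmul s (gmulr t v) = gmulr t (gmul s v)"
proof (cases v)
  case (Cons a m)
  show ?thesis
  proof (cases m rule: rev_cases)
    case Nil
    with Cons show ?thesis
      using gmulr_snoc[of t "[]" a] gmulr_snoc[of t "[s]" a] by (simp add: gmul_Cons)
  next
    case (snoc k b)
    then show ?thesis
      using Cons gmulr_snoc[of t "a # k" b] gmulr_snoc[of t k b] gmulr_snoc[of t "s # a # k" b]
      by (auto simp: gmul_Cons)
  qed
qed (use gmulr_snoc[of t "[]" s] in \<open>auto simp: gmul_Cons\<close>)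

text \<open>In the tree of reduced words a vertex other than the root has one neighbour nearer to
  the root, reached by cancelling the first letter, and L - 1 neighbours further away.\<close>

lemma sum_gmul:
  fixes f :: "nat list \<Rightarrow> 'a :: ab_group_add"
  assumes "v \<in> Wgrp L" "v \<noteq> []"
  shows "(\<Sum>s<L. f (gmul s v)) = f (tl v) + (\<Sum>s\<in>{..<L} - {hd v}. f (s # v))"
proof -
  obtain a m where v: "v = a # m" using assms(2) by (cases v) auto
  have "a < L" using assms(1) by (simp add: v Cons_in_Wgrp_iff)
  then have "(\<Sum>s<L. f (gmul s v)) = f (gmul a v) + (\<Sum>s\<in>{..<L} - {a}. f (gmul s v))"
    by (subst sum.remove[of _ a]) auto
  also have "(\<Sum>s\<in>{..<L} - {a}. f (gmul s v)) = (\<Sum>s\<in>{..<L} - {a}. f (s # v))"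
    by (intro sum.cong) (auto simp: v gmul_Cons)
  finally show ?thesis by (simp add: v gmul_Cons)
qed

subsection \<open>Functions commuting with the radial element\<close>

text \<open>The length j of the prefix fixes the place of u, so each word comes from exactly one
  pair (x, y), and sums over this set are sums over such pairs.\<close>

definition mid :: "nat \<Rightarrow> nat list \<Rightarrow> nat \<Rightarrow> nat \<Rightarrow> nat list set" where
  "mid L u j k = {w \<in> Wgrp L. \<exists>x y. w = x @ u @ y \<and> length x = j \<and> length y = k}"

lemma midD:
  assumes "w \<in> mid L u j k"
  shows "w \<in> Wgrp L" "length w = j + length u + k" "u \<noteq> [] \<Longrightarrow> w \<noteq> []"
  using assms by (auto simp: mid_def)

lemma finite_mid: "finite (mid L u j k)"
  by (rule finite_subset[OF _ finite_Wgrp_length[of L "j + length u + k"]]) (auto simp: mid_def)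

lemma mid_0_0: "u \<in> Wgrp L \<Longrightarrow> mid L u 0 0 = {u}"
  by (auto simp: mid_def)

text \<open>Reversal carries results on prepending letters over to appending letters.\<close>

lemma sum_mid_rev: "sum (\<lambda>w. f (rev w)) (mid L (rev u) k j) = sum f (mid L u j k)"
proof (rule sum.reindex_bij_witness[of _ rev rev])
  have "rev w \<in> mid L (rev u) k j" if "w \<in> mid L u j k" for w u j k
    using that by (fastforce simp: mid_def)
  from this[of _ u j k] this[of _ "rev u" k j]
  show "\<And>w. w \<in> mid L u j k \<Longrightarrow> rev w \<in> mid L (rev u) k j"
       "\<And>w. w \<in> mid L (rev u) k j \<Longrightarrow> rev w \<in> mid L u j k" by auto
qed auto

lemma Cons_in_mid_iff:
  assumes "u \<noteq> []"
  shows "s # v \<in> mid L u (Suc j) k \<longleftrightarrow> v \<in> mid L u j k \<and> s \<in> {..<L} - {hd v}"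
proof -
  have "(\<exists>x y. s # v = x @ u @ y \<and> length x = Suc j \<and> length y = k) \<longleftrightarrow>
        (\<exists>x y. v = x @ u @ y \<and> length x = j \<and> length y = k)"
    by (smt (verit) append_Cons length_Cons length_Suc_conv list.inject)
  moreover have "v \<noteq> []" if "v = x @ u @ y" for x y using that assms by auto
  ultimately show ?thesis by (auto simp: mid_def Cons_in_Wgrp_iff)
qed

lemma sum_mid_Suc:
  assumes "u \<noteq> []"
  shows "(\<Sum>v\<in>mid L u j k. \<Sum>s\<in>{..<L} - {hd v}. g (s # v)) = sum g (mid L u (Suc j) k)"
proof -
  have "(\<Sum>v\<in>mid L u j k. \<Sum>s\<in>{..<L} - {hd v}. g (s # v)) =
        (\<Sum>(v, s)\<in>Sigma (mid L u j k) (\<lambda>v. {..<L} - {hd v}). g (s # v))"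
    by (rule sum.Sigma) (auto simp: finite_mid)
  also have "\<dots> = sum g (mid L u (Suc j) k)"
  proof (rule sum.reindex_bij_witness[of _ "\<lambda>w. (tl w, hd w)" "\<lambda>(v, s). s # v"])
    fix w assume "w \<in> mid L u (Suc j) k"
    moreover from this obtain s v where "w = s # v" by (cases w) (auto simp: mid_def)
    ultimately show "(tl w, hd w) \<in> Sigma (mid L u j k) (\<lambda>v. {..<L} - {hd v})"
      "(case (tl w, hd w) of (v, s) \<Rightarrow> s # v) = w"
      using Cons_in_mid_iff[OF assms] by auto
  qed (auto simp: Cons_in_mid_iff[OF assms])
  finally show ?thesis .
qed

lemma sum_mid_Suc_tl:
  fixes f :: "nat list \<Rightarrow> complex"
  assumes "u \<noteq> []"
  shows "(\<Sum>w\<in>mid L u (Suc j) k. f (tl w)) = of_nat (L - 1) * sum f (mid L u j k)"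
proof -
  have "card ({..<L} - {hd v}) = L - 1" if "v \<in> mid L u j k" for v
  proof -
    have "hd v < L"
      using midD[OF that] assms by (cases v) (auto simp: Cons_in_Wgrp_iff)
    then show ?thesis by simp
  qed
  then show ?thesis
    by (simp add: sum_mid_Suc[OF assms, symmetric] sum_distrib_left)
qed

text \<open>With at least one letter before u, cancelling the first letter leaves u intact and hits
  each word of \<open>mid L u j k\<close> exactly L - 1 times; prepending a letter reaches each word
  of the next set once.\<close>

lemma sum_lap_mid_Suc:
  fixes f :: "nat list \<Rightarrow> complex"
  assumes "u \<noteq> []"
  shows "(\<Sum>v\<in>mid L u (Suc j) k. \<Sum>s<L. f (gmul s v)) =
         of_nat (L - 1) * sum f (mid L u j k) + sum f (mid L u (Suc (Suc j)) k)"
proof -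
  have "(\<Sum>v\<in>mid L u (Suc j) k. \<Sum>s<L. f (gmul s v)) =
        (\<Sum>v\<in>mid L u (Suc j) k. f (tl v) + (\<Sum>s\<in>{..<L} - {hd v}. f (s # v)))"
    by (intro sum.cong refl sum_gmul midD(1)) (use assms midD(3) in blast)+
  then show ?thesis
    by (simp add: sum.distrib sum_mid_Suc_tl sum_mid_Suc assms)
qed

text \<open>With no letter before u, cancellation destroys the first letter of u itself. This
  boundary term later relates u to its tail.\<close>

lemma sum_lap_mid_0:
  fixes f :: "nat list \<Rightarrow> complex"
  assumes "u \<noteq> []"
  shows "(\<Sum>v\<in>mid L u 0 k. \<Sum>s<L. f (gmul s v)) =
         (\<Sum>v\<in>mid L u 0 k. f (tl v)) + sum f (mid L u (Suc 0) k)"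
proof -
  have "(\<Sum>v\<in>mid L u 0 k. \<Sum>s<L. f (gmul s v)) =
        (\<Sum>v\<in>mid L u 0 k. f (tl v) + (\<Sum>s\<in>{..<L} - {hd v}. f (s # v)))"
    by (intro sum.cong refl sum_gmul midD(1)) (use assms midD(3) in blast)+
  then show ?thesis
    by (simp add: sum.distrib sum_mid_Suc assms)
qed

lemma sum_lapr_mid_Suc:
  fixes f :: "nat list \<Rightarrow> complex"
  assumes "u \<noteq> []"
  shows "(\<Sum>v\<in>mid L u j (Suc k). \<Sum>s<L. f (gmulr s v)) =
         of_nat (L - 1) * sum f (mid L u j k) + sum f (mid L u j (Suc (Suc k)))"
proof -
  have "(\<Sum>v\<in>mid L u j (Suc k). \<Sum>s<L. f (gmulr s v)) =
        (\<Sum>v\<in>mid L (rev u) (Suc k) j. \<Sum>s<L. f (rev (gmul s v)))"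
    by (subst sum_mid_rev[symmetric]) (simp add: gmulr_def)
  also have "\<dots> = of_nat (L - 1) * sum (\<lambda>w. f (rev w)) (mid L (rev u) k j)
                 + sum (\<lambda>w. f (rev w)) (mid L (rev u) (Suc (Suc k)) j)"
    using assms by (intro sum_lap_mid_Suc[where f = "\<lambda>w. f (rev w)"]) simp
  finally show ?thesis by (simp add: sum_mid_rev)
qed

text \<open>Each further letter on either side can be chosen in L - 1 ways: this is
  \<open>sum_mid_Suc_tl\<close> for the constant function 1, together with reversal.\<close>

lemma card_mid:
  assumes "u \<noteq> []" "u \<in> Wgrp L"
  shows "card (mid L u j k) = (L - 1) ^ (j + k)"
proof -
  have *: "of_nat (card (mid L u (Suc j) k)) = (of_nat ((L - 1) * card (mid L u j k)) :: complex)"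
    if "u \<noteq> []" for u j k
    using sum_mid_Suc_tl[OF that, where f = "\<lambda>_. 1" and L = L and j = j and k = k] by simp
  have "card (mid L u j k) = card (mid L (rev u) k j)" for u j k
    using sum_mid_rev[of "\<lambda>_. 1::nat" L u k j] by simp
  then have **: "card (mid L u j (Suc k)) = (L - 1) * card (mid L u j k)" for j k
    using *[of "rev u" k j] assms(1) by (metis of_nat_eq_iff rev_is_Nil_conv)
  show ?thesis
  proof (induction k)
    case 0
    show ?case
    proof (induction j)
      case (Suc j)
      then show ?case using *[OF assms(1), of j 0] by (metis add_0_right add_Suc of_nat_eq_iff power_Suc)
    qed (simp add: mid_0_0 assms)
  qed (simp add: **)
qed

text \<open>Cauchy-Schwarz against the constant 1, then enlarging the set to a whole sphere.\<close>

lemma norm_sum_mid_le: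
  fixes f :: "nat list \<Rightarrow> complex"
  assumes "u \<noteq> []" "u \<in> Wgrp L"
  shows "norm (sum f (mid L u j k)) \<le>
    sqrt (real (L - 1) ^ (j + k)) * L2_set (\<lambda>w. norm (f w)) {w \<in> Wgrp L. length w = j + length u + k}"
proof -
  have "norm (sum f (mid L u j k)) \<le> (\<Sum>w\<in>mid L u j k. \<bar>1\<bar> * \<bar>norm (f w)\<bar>)"
    by (simp add: norm_sum)
  also have "\<dots> \<le> L2_set (\<lambda>_. 1) (mid L u j k) * L2_set (\<lambda>w. norm (f w)) (mid L u j k)"
    by (rule L2_set_mult_ineq)
  also have "L2_set (\<lambda>_. 1) (mid L u j k) = sqrt (real (L - 1) ^ (j + k))"
    by (simp add: L2_set_def card_mid assms)
  also have "L2_set (\<lambda>w. norm (f w)) (mid L u j k) \<le>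
             L2_set (\<lambda>w. norm (f w)) {w \<in> Wgrp L. length w = j + length u + k}"
    unfolding L2_set_def
    by (intro real_sqrt_le_mono sum_mono2 finite_Wgrp_length) (auto dest: midD)
  finally show ?thesis by (simp add: mult_left_mono)
qed

section \<open>Recursion for the sums around a fixed middle word\<close>

locale radial_commuting =
  fixes L :: nat and f :: "nat list \<Rightarrow> complex"
  assumes L2: "2 \<le> L"
    and lap: "v \<in> Wgrp L \<Longrightarrow> (\<Sum>s<L. f (gmul s v)) = (\<Sum>s<L. f (gmulr s v))"
    and vanish: "(\<lambda>n. L2_set (\<lambda>w. norm (f w)) {w \<in> Wgrp L. length w = n}) \<longlonglongrightarrow> 0"
begin

definition F :: "nat list \<Rightarrow> nat \<Rightarrow> nat \<Rightarrow> complex" where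
  "F u j k = sum f (mid L u j k)"

text \<open>Compares two adjacent positions of u in words of the same length |u| + j + k +
  1.\<close>

definition G :: "nat list \<Rightarrow> nat \<Rightarrow> nat \<Rightarrow> complex" where
  "G u j k = F u (Suc j) k - F u j (Suc k)"

text \<open>Summing \<open>lap\<close> over the set gives (L-1) F(j,k+1) + F(j+2,k+1) = (L-1)
  F(j+1,k) + F(j+1,k+2), which regroups into the claim.\<close>

lemma G_Suc_Suc:
  assumes "u \<noteq> []"
  shows "G u (Suc j) (Suc k) = of_nat (L - 1) * G u j k"
proof -
  have "(\<Sum>v\<in>mid L u (Suc j) (Suc k). \<Sum>s<L. f (gmul s v)) =
        (\<Sum>v\<in>mid L u (Suc j) (Suc k). \<Sum>s<L. f (gmulr s v))"
    by (intro sum.cong lap) (auto dest: midD)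
  then show ?thesis
    by (simp add: sum_lap_mid_Suc sum_lapr_mid_Suc assms G_def F_def algebra_simps)
qed

lemma G_diagonal: "u \<noteq> [] \<Longrightarrow> G u n (n + k) = of_nat (L - 1) ^ n * G u 0 k"
  by (induction n) (auto simp: G_Suc_Suc)

text \<open>The same summation at the boundary j = 0, where the shorter left neighbours have lost
  the first letter of u and stay as an explicit sum.\<close>

lemma G_0_Suc:
  assumes "u \<noteq> []"
  shows "G u 0 (Suc k) = of_nat (L - 1) * F u 0 k - (\<Sum>v\<in>mid L u 0 (Suc k). f (tl v))"
proof -
  have "(\<Sum>v\<in>mid L u 0 (Suc k). \<Sum>s<L. f (gmul s v)) =
        (\<Sum>v\<in>mid L u 0 (Suc k). \<Sum>s<L. f (gmulr s v))"
    by (intro sum.cong lap) (auto dest: midD)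
  then show ?thesis
    by (simp add: sum_lap_mid_0 sum_lapr_mid_Suc assms G_def F_def algebra_simps)
qed

lemma sum_tl_Cons:
  assumes "u \<noteq> []" "a # u \<in> Wgrp L"
  shows "(\<Sum>v\<in>mid L (a # u) 0 k. f (tl v)) = F u 0 k"
  unfolding F_def
proof (rule sum.reindex_bij_witness[of _ "\<lambda>w. a # w" tl])
  fix w assume "w \<in> mid L u 0 k"
  then show "a # w \<in> mid L (a # u) 0 k"
    using assms by (auto simp: mid_def Cons_in_Wgrp_iff)
qed (use assms in \<open>auto simp: mid_def Cons_in_Wgrp_iff\<close>)

text \<open>The tails are the reduced words of length k + 1 that do not start with a: the sphere
  minus the words starting with a. The sphere term does not depend on a.\<close>

lemma sum_tl_singleton:
  assumes "a < L"
  shows "(\<Sum>v\<in>mid L [a] 0 (Suc k). f (tl v)) = sum f {w \<in> Wgrp L. length w = Suc k} - F [a] 0 k"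
proof -
  have sub: "mid L [a] 0 k \<subseteq> {w \<in> Wgrp L. length w = Suc k}"
    by (auto simp: mid_def)
  have "(\<Sum>v\<in>mid L [a] 0 (Suc k). f (tl v)) =
        sum f ({w \<in> Wgrp L. length w = Suc k} - mid L [a] 0 k)"
  proof (rule sum.reindex_bij_witness[of _ "\<lambda>w. a # w" tl])
    fix w assume w: "w \<in> {w \<in> Wgrp L. length w = Suc k} - mid L [a] 0 k"
    then show "a # w \<in> mid L [a] 0 (Suc k)"
      using assms by (cases w) (auto simp: mid_def Cons_in_Wgrp_iff)
  qed (auto simp: mid_def Cons_in_Wgrp_iff)
  then show ?thesis
    using sub by (simp add: F_def sum_diff finite_Wgrp_length)
qed

text \<open>By \<open>norm_sum_mid_le\<close> each G is at most a constant times (L-1)^(n+1) times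
  the norm of f on a sphere whose radius grows with n, and the latter tends to 0 by
  \<open>vanish\<close>.\<close>

lemma G_diff_tendsto_0:
  assumes "u \<noteq> []" "u \<in> Wgrp L" "u' \<noteq> []" "u' \<in> Wgrp L"
  shows "(\<lambda>n. (G u n (n + Suc k) - G u' n (n + Suc k)) / of_nat (L - 1) ^ Suc n) \<longlonglongrightarrow> 0"
proof -
  define Q where "Q = real (L - 1)"
  have Q: "Q \<ge> 1" using L2 by (simp add: Q_def)
  define e where "e n = L2_set (\<lambda>w. norm (f w)) {w \<in> Wgrp L. length w = n}" for n
  have one: "norm (G u n (n + Suc k)) / Q ^ Suc n \<le> 2 * sqrt (Q ^ k) * e (n + (n + k + 2 + length u))"
    if u: "u \<noteq> []" "u \<in> Wgrp L" for u n
  proof -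
    \<comment> \<open>The 2n + k + 2 free letters give Q^(2n+k+2) words; the square root is Q^(n+1)
      up to a factor independent of n, which is why the quotient has exponent
      \<open>Suc n\<close>.\<close>
    have sq: "sqrt (Q ^ (n + n + k + 2)) = Q ^ Suc n * sqrt (Q ^ k)"
    proof -
      have "Q ^ (n + n + k + 2) = (Q ^ Suc n)\<^sup>2 * Q ^ k"
        by (simp add: power_add power2_eq_square algebra_simps)
      then show ?thesis using Q by (simp add: real_sqrt_mult del: power_Suc)
    qed
    have idx: "Suc n + (n + Suc k) = n + n + k + 2" "n + Suc (n + Suc k) = n + n + k + 2"
        "Suc n + length u + (n + Suc k) = n + (n + k + 2 + length u)"
        "n + length u + Suc (n + Suc k) = n + (n + k + 2 + length u)"
      by simp_all
    have "norm (G u n (n + Suc k)) \<le> norm (F u (Suc n) (n + Suc k)) + norm (F u n (Suc (n + Suc k)))"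
      unfolding G_def by (rule norm_triangle_ineq4)
    also have "\<dots> \<le> 2 * (Q ^ Suc n * sqrt (Q ^ k)) * e (n + (n + k + 2 + length u))"
      using norm_sum_mid_le[OF u, of f "Suc n" "n + Suc k"]
        norm_sum_mid_le[OF u, of f n "Suc (n + Suc k)"]
      unfolding F_def[symmetric] e_def[symmetric] Q_def[symmetric] idx sq by linarith
    finally show ?thesis using Q by (simp add: divide_simps mult_ac)
  qed
  have ez: "(\<lambda>n. e (n + (n + k + 2 + l))) \<longlonglongrightarrow> 0" for l
    using vanish unfolding e_def[symmetric]
    by (rule LIMSEQ_subseq_LIMSEQ[unfolded o_def]) (auto simp: strict_mono_def)
  have lim: "(\<lambda>n. 2 * sqrt (Q ^ k) * e (n + (n + k + 2 + length u))
                 + 2 * sqrt (Q ^ k) * e (n + (n + k + 2 + length u'))) \<longlonglongrightarrow> 0"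
    by (rule tendsto_eq_intros ez refl | simp)+
  show ?thesis
  proof (rule Lim_null_comparison[OF _ lim], rule eventuallyI)
    fix n
    have "norm ((G u n (n + Suc k) - G u' n (n + Suc k)) / of_nat (L - 1) ^ Suc n)
       \<le> norm (G u n (n + Suc k)) / Q ^ Suc n + norm (G u' n (n + Suc k)) / Q ^ Suc n"
      unfolding norm_divide norm_power norm_of_nat Q_def[symmetric] add_divide_distrib[symmetric]
      using Q by (intro divide_right_mono norm_triangle_ineq4) simp
    with one[OF assms(1,2), of n] one[OF assms(3,4), of n]
    show "norm ((G u n (n + Suc k) - G u' n (n + Suc k)) / of_nat (L - 1) ^ Suc n)
       \<le> 2 * sqrt (Q ^ k) * e (n + (n + k + 2 + length u))
       + 2 * sqrt (Q ^ k) * e (n + (n + k + 2 + length u'))" by linarith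
  qed
qed

text \<open>Along a diagonal G is geometric with ratio L - 1, so the normalized difference is
  constant in n; having limit 0, it is 0.\<close>

lemma G_0_eq:
  assumes "u \<noteq> []" "u \<in> Wgrp L" "u' \<noteq> []" "u' \<in> Wgrp L"
  shows "G u 0 (Suc k) = G u' 0 (Suc k)"
proof -
  have "(G u n (n + Suc k) - G u' n (n + Suc k)) / of_nat (L - 1) ^ Suc n =
        (G u 0 (Suc k) - G u' 0 (Suc k)) / of_nat (L - 1)" for n
    using G_diagonal[of u n "Suc k"] G_diagonal[of u' n "Suc k"] assms(1,3) L2
    by (simp add: divide_simps algebra_simps)
  with G_diff_tendsto_0[OF assms, of k]
  have "(\<lambda>n::nat. (G u 0 (Suc k) - G u' 0 (Suc k)) / of_nat (L - 1)) \<longlonglongrightarrow> 0" by simp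
  then have "(G u 0 (Suc k) - G u' 0 (Suc k)) / of_nat (L - 1) = 0"
    using LIMSEQ_const_iff by blast
  then show ?thesis using L2 by (auto simp: of_nat_eq_0_iff)
qed

text \<open>Induction on the length of u. Passing to the tail raises k by one, so k must stay
  arbitrary. Once the boundary sums agree, equality of the G isolates the F of the longer
  words.\<close>

lemma F_0_eq:
  assumes "u \<noteq> []" "u \<in> Wgrp L" "u' \<in> Wgrp L" "length u = length u'"
  shows "F u 0 k = F u' 0 k"
  using assms
proof (induction u arbitrary: u' k)
  case (Cons a m)
  then obtain b m' where u': "u' = b # m'" by (cases u') auto
  have G: "G (a # m) 0 (Suc k) = G (b # m') 0 (Suc k)"
    using Cons.prems u' by (intro G_0_eq) auto
  have ab: "a < L" "b < L" using Cons.prems u' by (auto simp: Cons_in_Wgrp_iff)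
  show ?case
  proof (cases "m = []")
    case True
    then have "m' = []" using Cons.prems u' by simp
    \<comment> \<open>The sphere sums cancel, and the words removed from the sphere return with a
      plus sign, so F [a] 0 k gets the factor (L - 1) + 1 = L.\<close>
    with True G have "of_nat (L - 1) * F [a] 0 k + F [a] 0 k = of_nat (L - 1) * F [b] 0 k + F [b] 0 k"
      by (simp add: G_0_Suc sum_tl_singleton ab)
    then have "(of_nat (L - 1) + 1) * (F [a] 0 k - F [b] 0 k) = 0"
      by (simp add: algebra_simps)
    moreover have "(of_nat (L - 1) + 1 :: complex) = of_nat L"
      using L2 by (simp add: of_nat_diff)
    ultimately show ?thesis using True \<open>m' = []\<close> u' L2 by auto
  next
    case False
    then have "m' \<noteq> []" using Cons.prems u' by auto
    moreover have "F m 0 (Suc k) = F m' 0 (Suc k)"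
      using Cons.prems False u' by (intro Cons.IH) (auto simp: Cons_in_Wgrp_iff)
    ultimately have "of_nat (L - 1) * F (a # m) 0 k = of_nat (L - 1) * F (b # m') 0 k"
      using G False Cons.prems u' by (simp add: G_0_Suc sum_tl_Cons)
    then show ?thesis using u' L2 by (auto simp: of_nat_eq_0_iff)
  qed
qed simp

lemma radial:
  assumes "u \<in> Wgrp L" "u' \<in> Wgrp L" "length u = length u'"
  shows "f u = f u'"
  using F_0_eq[of u u' 0] assms by (cases "u = []") (auto simp: F_def mid_0_0)

end

subsection \<open>Square-summable functions\<close>

lemma L2_le_l2norm:
  assumes "f \<in> l2 L" "finite F"
  shows "L2_set (\<lambda>v. cmod (f v)) F \<le> l2norm f"
  using assms unfolding L2_set_def l2norm_def l2_def
  by (intro real_sqrt_le_mono finite_sum_le_infsum) auto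

text \<open>Membership and norm bound both follow from one bound uniform over finite sets, so that
  finite inequalities for \<open>L2_set\<close> carry over to the whole group.\<close>

lemma l2_intro:
  assumes "\<And>v. v \<notin> Wgrp L \<Longrightarrow> f v = 0"
    and C: "\<And>F. finite F \<Longrightarrow> F \<subseteq> Wgrp L \<Longrightarrow> L2_set (\<lambda>v. cmod (f v)) F \<le> C"
  shows "f \<in> l2 L" "l2norm f \<le> C"
proof -
  have C0: "0 \<le> C" using C[of "{}"] by simp
  have "(\<Sum>v\<in>F. (cmod (f v))\<^sup>2) \<le> C\<^sup>2" if "finite F" for F
  proof -
    have "(\<Sum>v\<in>F. (cmod (f v))\<^sup>2) = (\<Sum>v\<in>F \<inter> Wgrp L. (cmod (f v))\<^sup>2)"
      using that assms(1) by (intro sum.mono_neutral_right) auto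
    also have "\<dots> = (L2_set (\<lambda>v. cmod (f v)) (F \<inter> Wgrp L))\<^sup>2"
      by (simp add: L2_set_def sum_nonneg)
    also have "\<dots> \<le> C\<^sup>2" using that C0 by (intro power_mono C L2_set_nonneg) auto
    finally show ?thesis .
  qed
  note bound = this
  then have sm: "(\<lambda>v. (cmod (f v))\<^sup>2) summable_on UNIV"
    by (intro nonneg_bdd_above_summable_on) (auto intro!: bdd_aboveI)
  with assms(1) show "f \<in> l2 L" by (simp add: l2_def)
  have "(\<Sum>\<^sub>\<infinity>v. (cmod (f v))\<^sup>2) \<le> C\<^sup>2"
    using sm bound by (intro infsum_le_finite_sums) auto
  then show "l2norm f \<le> C" using C0 by (auto simp: l2norm_def intro: real_le_lsqrt)
qed

lemma l2_outside: "f \<in> l2 L \<Longrightarrow> v \<notin> Wgrp L \<Longrightarrow> f v = 0"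
  by (simp add: l2_def)

lemma l2norm_nonneg: "0 \<le> l2norm f"
  by (simp add: l2norm_def infsum_nonneg)

lemma norm_le_l2norm: "f \<in> l2 L \<Longrightarrow> cmod (f v) \<le> l2norm f"
  using L2_le_l2norm[of f L "{v}"] by simp

lemma l2_zero [simp]: "0 \<in> l2 L"
  by (simp add: l2_def)

lemma l2_add:
  assumes "f \<in> l2 L" "g \<in> l2 L"
  shows "f + g \<in> l2 L" "l2norm (f + g) \<le> l2norm f + l2norm g"
proof -
  have "L2_set (\<lambda>v. cmod ((f + g) v)) F \<le> l2norm f + l2norm g" if "finite F" for F
  proof -
    have "L2_set (\<lambda>v. cmod ((f + g) v)) F \<le> L2_set (\<lambda>v. cmod (f v) + cmod (g v)) F"
      by (intro L2_set_mono) (auto intro: norm_triangle_ineq)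
    also have "\<dots> \<le> L2_set (\<lambda>v. cmod (f v)) F + L2_set (\<lambda>v. cmod (g v)) F"
      by (rule L2_set_triangle_ineq)
    finally show ?thesis using L2_le_l2norm[OF assms(1) that] L2_le_l2norm[OF assms(2) that] by linarith
  qed
  then show "f + g \<in> l2 L" "l2norm (f + g) \<le> l2norm f + l2norm g"
    by (auto intro!: l2_intro[of L] simp: l2_outside[OF assms(1)] l2_outside[OF assms(2)])
qed

lemma l2_scale:
  assumes "f \<in> l2 L"
  shows "(\<lambda>v. c * f v) \<in> l2 L" "l2norm (\<lambda>v. c * f v) \<le> cmod c * l2norm f"
proof -
  have "L2_set (\<lambda>v. cmod (c * f v)) F \<le> cmod c * l2norm f" if "finite F" for F
    using L2_le_l2norm[OF assms that] by (simp add: norm_mult L2_set_right_distrib[symmetric] mult_left_mono)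
  then show "(\<lambda>v. c * f v) \<in> l2 L" "l2norm (\<lambda>v. c * f v) \<le> cmod c * l2norm f"
    by (auto intro!: l2_intro[of L] simp: l2_outside[OF assms])
qed

lemma l2_dominated:
  assumes "f \<in> l2 L" "\<And>v. cmod (g v) \<le> cmod (f v)"
  shows "g \<in> l2 L" "l2norm g \<le> l2norm f"
proof -
  have "L2_set (\<lambda>v. cmod (g v)) F \<le> l2norm f" if "finite F" for F
    using L2_le_l2norm[OF assms(1) that] L2_set_mono[of F "\<lambda>v. cmod (g v)" "\<lambda>v. cmod (f v)"] assms(2)
    by fastforce
  moreover have "g v = 0" if "v \<notin> Wgrp L" for v
    using assms that by (metis l2_outside norm_le_zero_iff norm_zero)
  ultimately show "g \<in> l2 L" "l2norm g \<le> l2norm f"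
    by (auto intro!: l2_intro)
qed

lemma l2_reindex:
  assumes "f \<in> l2 L" "inj_on \<phi> (Wgrp L)"
  shows "(\<lambda>v. if v \<in> Wgrp L then f (\<phi> v) else 0) \<in> l2 L" (is "?g \<in> _")
    and "l2norm (\<lambda>v. if v \<in> Wgrp L then f (\<phi> v) else 0) \<le> l2norm f"
proof -
  have "L2_set (\<lambda>v. cmod (?g v)) F \<le> l2norm f" if "finite F" "F \<subseteq> Wgrp L" for F
  proof -
    have "L2_set (\<lambda>v. cmod (?g v)) F = L2_set (\<lambda>v. cmod (f v)) (\<phi> ` F)"
      using that assms(2) by (auto simp: L2_set_def sum.reindex inj_on_subset intro!: sum.cong)
    with L2_le_l2norm[OF assms(1), of "\<phi> ` F"] that show ?thesis by simp
  qed
  then show "?g \<in> l2 L" "l2norm ?g \<le> l2norm f"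
    by (auto intro!: l2_intro)
qed

section \<open>Truncations, tails and basis vectors\<close>

definition restr :: "nat list set \<Rightarrow> (nat list \<Rightarrow> complex) \<Rightarrow> nat list \<Rightarrow> complex" where
  "restr F f v = (if v \<in> F then f v else 0)"

lemma restr_l2: "f \<in> l2 L \<Longrightarrow> restr F f \<in> l2 L"
  by (rule l2_dominated(1)[of f]) (auto simp: restr_def)

lemma restr_compl: "f = restr F f + restr (- F) f"
  by (auto simp: restr_def fun_eq_iff)

lemma infsum_restr: "(\<Sum>\<^sub>\<infinity>v. (cmod (restr F f v))\<^sup>2) = (\<Sum>\<^sub>\<infinity>v\<in>F. (cmod (f v))\<^sup>2)"
  by (rule infsum_cong_neutral) (auto simp: restr_def)

text \<open>Stated for every E containing F, so that it applies to F itself and to balls of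
  words.\<close>

lemma l2norm_tail_less:
  assumes "f \<in> l2 L" "0 < e"
  obtains F where "finite F" "F \<subseteq> Wgrp L"
    "\<And>E. F \<subseteq> E \<Longrightarrow> l2norm (restr (- E) f) < e"
proof -
  let ?g = "\<lambda>v. (cmod (f v))\<^sup>2"
  have sm: "?g summable_on UNIV" using assms(1) by (simp add: l2_def)
  then have "(?g has_sum (\<Sum>\<^sub>\<infinity>v. ?g v)) UNIV" by (rule has_sum_infsum)
  then obtain F where F: "finite F" "dist (sum ?g F) (\<Sum>\<^sub>\<infinity>v. ?g v) < e\<^sup>2"
    using assms(2) 
    unfolding has_sum_def tendsto_iff eventually_finite_subsets_at_top
    by (metis subset_UNIV subset_refl zero_less_power)
  let ?F = "F \<inter> Wgrp L"
  have eq: "sum ?g ?F = sum ?g F"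
    using F(1) assms(1) by (intro sum.mono_neutral_left) (auto simp: l2_outside)
  have "l2norm (restr (- E) f) < e" if E: "?F \<subseteq> E" for E
  proof -
    have sm': "?g summable_on A" for A using sm summable_on_subset_banach by blast
    have "(\<Sum>\<^sub>\<infinity>v. (cmod (restr (- E) f v))\<^sup>2) = (\<Sum>\<^sub>\<infinity>v\<in>-E. ?g v)" by (rule infsum_restr)
    also have "\<dots> \<le> (\<Sum>\<^sub>\<infinity>v\<in>-?F. ?g v)"
      using sm' E by (intro infsum_mono_neutral) auto
    also have "\<dots> = (\<Sum>\<^sub>\<infinity>v. ?g v) - sum ?g ?F"
    proof -
      have "?F \<union> - ?F = UNIV" "?F \<inter> - ?F = {}" by blast+
      with infsum_Un_disjoint[OF sm' sm', of ?F "- ?F"] show ?thesis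
        using F(1) by (simp del: Compl_Int)
    qed
    also have "\<dots> < e\<^sup>2" using F(2) eq by (simp add: dist_real_def)
    finally show ?thesis
      unfolding l2norm_def using assms(2) by (metis abs_of_pos real_sqrt_abs real_sqrt_less_mono)
  qed
  with F(1) show ?thesis by (intro that[of ?F]) auto
qed

definition delta :: "nat list \<Rightarrow> nat list \<Rightarrow> complex" where
  "delta w v = (if v = w then 1 else 0)"

lemma delta_l2: "w \<in> Wgrp L \<Longrightarrow> delta w \<in> l2 L"
proof (rule l2_intro(1)[where C = 1])
  fix F :: "nat list set" assume "finite F"
  then have "(\<Sum>v\<in>F. (cmod (delta w v))\<^sup>2) \<le> 1"
    by (simp add: delta_def if_distrib[of cmod] if_distrib[of "\<lambda>x. x\<^sup>2"] cong: if_cong)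
  then show "L2_set (\<lambda>v. cmod (delta w v)) F \<le> 1" by (simp add: L2_set_def)
qed (auto simp: delta_def)

lemma sum_fun_apply: "sum f A x = (\<Sum>a\<in>A. f a x)"
  by (induction A rule: infinite_finite_induct) auto

lemma restr_finite_eq_sum: "finite F \<Longrightarrow> restr F f = (\<Sum>u\<in>F. (\<lambda>v. f u * delta u v))"
  by (rule ext) (auto simp: restr_def delta_def sum_fun_apply if_distrib cong: if_cong)

subsection \<open>Bounded operators and commutants\<close>

lemma bdd_opD:
  assumes "bdd_op L A"
  shows bdd_op_outside: "f \<notin> l2 L \<Longrightarrow> A f = 0"
    and bdd_op_l2: "A f \<in> l2 L"
    and bdd_op_add: "f \<in> l2 L \<Longrightarrow> g \<in> l2 L \<Longrightarrow> A (f + g) = A f + A g"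
    and bdd_op_scale: "f \<in> l2 L \<Longrightarrow> A (\<lambda>v. c * f v) = (\<lambda>v. c * A f v)"
  using assms by (cases "f \<in> l2 L"; auto simp: bdd_op_def)+

lemma bdd_op_bound:
  assumes "bdd_op L A"
  obtains C where "0 \<le> C" "\<And>f. f \<in> l2 L \<Longrightarrow> l2norm (A f) \<le> C * l2norm f"
proof -
  obtain C where C: "\<forall>f\<in>l2 L. l2norm (A f) \<le> C * l2norm f"
    using assms by (auto simp: bdd_op_def)
  have "l2norm (A f) \<le> max 0 C * l2norm f" if "f \<in> l2 L" for f
    using C that l2norm_nonneg[of f] by (meson max.cobounded2 mult_right_mono order_trans)
  then show ?thesis by (intro that[of "max 0 C"]) auto
qed

lemma bdd_op_0: "bdd_op L A \<Longrightarrow> A 0 = 0"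
  using bdd_op_scale[OF _ l2_zero, of L A 0] by (simp add: zero_fun_def)

lemma bdd_op_sum_apply:
  assumes "bdd_op L A" "\<And>i. i \<in> I \<Longrightarrow> f i \<in> l2 L"
  shows "A (sum f I) = (\<Sum>i\<in>I. A (f i))" "sum f I \<in> l2 L"
proof -
  have "A (sum f I) = (\<Sum>i\<in>I. A (f i)) \<and> sum f I \<in> l2 L"
    using assms(2) by (induction I rule: infinite_finite_induct)
      (auto simp: bdd_op_0[OF assms(1)] bdd_op_add[OF assms(1)] l2_add)
  then show "A (sum f I) = (\<Sum>i\<in>I. A (f i))" "sum f I \<in> l2 L" by auto
qed

lemma bdd_opI:
  assumes "\<And>f. f \<notin> l2 L \<Longrightarrow> A f = 0"
    and "\<And>f. f \<in> l2 L \<Longrightarrow> A f \<in> l2 L"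
    and "\<And>f g. f \<in> l2 L \<Longrightarrow> g \<in> l2 L \<Longrightarrow> A (f + g) = A f + A g"
    and "\<And>f c. f \<in> l2 L \<Longrightarrow> A (\<lambda>v. c * f v) = (\<lambda>v. c * A f v)"
    and "\<And>f. f \<in> l2 L \<Longrightarrow> l2norm (A f) \<le> C * l2norm f"
  shows "bdd_op L A"
  using assms unfolding bdd_op_def by blast

lemma bdd_op_comp:
  assumes A: "bdd_op L A" and B: "bdd_op L B"
  shows "bdd_op L (A \<circ> B)"
proof -
  obtain C where C: "0 \<le> C" "\<And>f. f \<in> l2 L \<Longrightarrow> l2norm (A f) \<le> C * l2norm f"
    using A by (elim bdd_op_bound) auto
  obtain C' where C': "\<And>f. f \<in> l2 L \<Longrightarrow> l2norm (B f) \<le> C' * l2norm f"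
    using B by (elim bdd_op_bound) auto
  show ?thesis
  proof (rule bdd_opI[where C = "C * C'"])
    fix f assume f: "f \<in> l2 L"
    have "l2norm (A (B f)) \<le> C * (C' * l2norm f)"
      using C C'[OF f] bdd_op_l2[OF B] by (meson mult_left_mono order_trans)
    then show "l2norm ((A \<circ> B) f) \<le> C * C' * l2norm f" by (simp add: mult.assoc)
  qed (simp_all add: bdd_op_outside[OF B] bdd_op_0[OF A] bdd_op_l2[OF A] bdd_op_l2[OF B]
         bdd_op_add[OF A] bdd_op_add[OF B] bdd_op_scale[OF A] bdd_op_scale[OF B])
qed

lemma bdd_op_zero: "bdd_op L 0"
  by (rule bdd_opI[where C = 0]) (auto simp: l2norm_def)

lemma bdd_op_plus:
  assumes A: "bdd_op L A" and B: "bdd_op L B"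
  shows "bdd_op L (A + B)"
proof -
  obtain C where C: "\<And>f. f \<in> l2 L \<Longrightarrow> l2norm (A f) \<le> C * l2norm f"
    using A by (elim bdd_op_bound) auto
  obtain C' where C': "\<And>f. f \<in> l2 L \<Longrightarrow> l2norm (B f) \<le> C' * l2norm f"
    using B by (elim bdd_op_bound) auto
  show ?thesis
  proof (rule bdd_opI[where C = "C + C'"])
    fix f assume f: "f \<in> l2 L"
    show "l2norm ((A + B) f) \<le> (C + C') * l2norm f"
      using C[OF f] C'[OF f] l2_add(2)[OF bdd_op_l2[OF A] bdd_op_l2[OF B], of f f]
      by (simp add: algebra_simps)
  qed (simp_all add: bdd_op_outside[OF A] bdd_op_outside[OF B] l2_add bdd_op_l2[OF A] bdd_op_l2[OF B]
         bdd_op_add[OF A] bdd_op_add[OF B] bdd_op_scale[OF A] bdd_op_scale[OF B] fun_eq_iff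
         distrib_left)
qed

lemma bdd_op_scaled:
  assumes A: "bdd_op L A"
  shows "bdd_op L (\<lambda>f v. c * A f v)"
proof -
  obtain C where C: "\<And>f. f \<in> l2 L \<Longrightarrow> l2norm (A f) \<le> C * l2norm f"
    using A by (elim bdd_op_bound) auto
  show ?thesis
  proof (rule bdd_opI[where C = "cmod c * C"])
    fix f assume f: "f \<in> l2 L"
    show "l2norm (\<lambda>v. c * A f v) \<le> cmod c * C * l2norm f"
      using mult_left_mono[OF C[OF f] norm_ge_zero[of c]] l2_scale(2)[OF bdd_op_l2[OF A], of c f]
      by (simp add: mult.assoc)
  qed (simp_all add: bdd_op_outside[OF A] l2_scale bdd_op_l2[OF A]
         bdd_op_add[OF A] bdd_op_scale[OF A] fun_eq_iff distrib_left mult.left_commute)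
qed

lemma bdd_op_sum: "(\<And>i. i \<in> I \<Longrightarrow> bdd_op L (A i)) \<Longrightarrow> bdd_op L (sum A I)"
  by (induction I rule: infinite_finite_induct) (auto simp: bdd_op_zero bdd_op_plus)

lemma bdd_op_Id: "bdd_op L (Id_op L)"
  by (auto simp: bdd_op_def Id_op_def l2_add l2_scale intro!: exI[of _ 1])

text \<open>A bound on one coordinate of A z may be checked on finite truncations of z, since A is
  bounded and the tails have small norm.\<close>

lemma bdd_op_cmod_le:
  assumes "bdd_op L A" "z \<in> l2 L"
    and K: "\<And>F. finite F \<Longrightarrow> F \<subseteq> Wgrp L \<Longrightarrow> cmod (A (restr F z) w) \<le> K"
  shows "cmod (A z w) \<le> K"
proof (rule field_le_epsilon)
  fix e :: real assume "0 < e"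
  obtain C where C: "0 \<le> C" "\<And>f. f \<in> l2 L \<Longrightarrow> l2norm (A f) \<le> C * l2norm f"
    using assms(1) by (elim bdd_op_bound) auto
  \<comment> \<open>The denominator C + 1 is positive even for C = 0.\<close>
  obtain F where F: "finite F" "F \<subseteq> Wgrp L" "\<And>E. F \<subseteq> E \<Longrightarrow> l2norm (restr (- E) z) < e / (C + 1)"
    using assms(2) C(1) \<open>0 < e\<close> by (elim l2norm_tail_less[of z L "e / (C + 1)"]) auto
  have "A z = A (restr F z) + A (restr (- F) z)"
    using assms by (metis bdd_op_add restr_compl restr_l2)
  then have "cmod (A z w) \<le> cmod (A (restr F z) w) + cmod (A (restr (- F) z) w)"
    by (simp add: norm_triangle_ineq)
  also have "cmod (A (restr (- F) z) w) \<le> C * l2norm (restr (- F) z)"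
    using norm_le_l2norm[OF bdd_op_l2[OF assms(1)]] C(2) restr_l2[OF assms(2)] order_trans by blast
  also have "\<dots> \<le> C * (e / (C + 1))"
    using F(3)[of F] C(1) by (intro mult_left_mono) auto
  also have "\<dots> \<le> e" using C(1) \<open>0 < e\<close> by (simp add: field_simps)
  finally show "cmod (A z w) \<le> K + e" using K[OF F(1,2)] by linarith
qed

lemma bdd_op_restr_apply:
  assumes "bdd_op L A" "finite F" "F \<subseteq> Wgrp L"
  shows "A (restr F z) w = (\<Sum>u\<in>F. z u * A (delta u) w)"
  using assms
  by (subst restr_finite_eq_sum)
     (auto simp: bdd_op_sum_apply(1)[OF assms(1)] l2_scale delta_l2 subset_eq sum_fun_apply
                 bdd_op_scale[OF assms(1)] intro!: sum.cong)

text \<open>The difference kills all basis vectors, hence all finite truncations, and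
  \<open>bdd_op_cmod_le\<close> applies with bound 0.\<close>

lemma bdd_op_eqI:
  assumes "bdd_op L A" "bdd_op L B" "\<And>u. u \<in> Wgrp L \<Longrightarrow> A (delta u) = B (delta u)"
  shows "A = B"
proof (intro ext)
  fix z w
  define D where "D = A + (\<lambda>f v. (-1) * B f v)"
  have D: "bdd_op L D" unfolding D_def by (intro bdd_op_plus bdd_op_scaled assms)
  show "A z w = B z w"
  proof (cases "z \<in> l2 L")
    case True
    have "cmod (D z w) \<le> 0"
      using D True
    proof (rule bdd_op_cmod_le)
      fix F assume F: "finite F" "F \<subseteq> Wgrp L"
      then have "D (restr F z) w = 0"
        unfolding bdd_op_restr_apply[OF D F]
        by (intro sum.neutral) (auto simp: D_def assms(3) subset_eq)
      then show "cmod (D (restr F z) w) \<le> 0" by simp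
    qed
    then show ?thesis by (simp add: D_def)
  qed (simp add: bdd_op_outside[OF assms(1)] bdd_op_outside[OF assms(2)])
qed

section \<open>Commutants and bicommutants\<close>

lemma commutant_bdd_op: "A \<in> commutant L X \<Longrightarrow> bdd_op L A"
  by (simp add: commutant_def)

lemma commutant_apply: "A \<in> commutant L X \<Longrightarrow> x \<in> X \<Longrightarrow> A (x f) = x (A f)"
  by (auto simp: commutant_def fun_eq_iff)

lemma commutantI:
  "bdd_op L A \<Longrightarrow> (\<And>x f. x \<in> X \<Longrightarrow> A (x f) = x (A f)) \<Longrightarrow> A \<in> commutant L X"
  by (auto simp: commutant_def)

lemma commutant_antimono: "X \<subseteq> Y \<Longrightarrow> commutant L Y \<subseteq> commutant L X"
  by (auto simp: commutant_def)

lemma bicommutant_superset: "x \<in> X \<Longrightarrow> bdd_op L x \<Longrightarrow> x \<in> commutant L (commutant L X)"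
  by (metis commutantI commutant_apply)

lemma bicommutant_plus:
  assumes A: "A \<in> commutant L (commutant L X)" and B: "B \<in> commutant L (commutant L X)"
  shows "A + B \<in> commutant L (commutant L X)"
proof (rule commutantI)
  fix x f assume x: "x \<in> commutant L X"
  show "(A + B) (x f) = x ((A + B) f)"
    using commutant_apply[OF A x] commutant_apply[OF B x]
    by (simp add: bdd_op_add[OF commutant_bdd_op[OF x]] bdd_op_l2 commutant_bdd_op[OF A] commutant_bdd_op[OF B])
qed (intro bdd_op_plus commutant_bdd_op[OF A] commutant_bdd_op[OF B])

lemma bicommutant_scaled:
  assumes A: "A \<in> commutant L (commutant L X)"
  shows "(\<lambda>f v. c * A f v) \<in> commutant L (commutant L X)"
proof (rule commutantI)
  fix x f assume x: "x \<in> commutant L X"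
  show "(\<lambda>v. c * A (x f) v) = x (\<lambda>v. c * A f v)"
    using commutant_apply[OF A x]
    by (simp add: bdd_op_scale[OF commutant_bdd_op[OF x]] bdd_op_l2 commutant_bdd_op[OF A])
qed (intro bdd_op_scaled commutant_bdd_op[OF A])

lemma commutant_comp:
  assumes A: "A \<in> commutant L X" and B: "B \<in> commutant L X"
  shows "A \<circ> B \<in> commutant L X"
  by (rule commutantI)
     (simp_all add: bdd_op_comp commutant_bdd_op[OF A] commutant_bdd_op[OF B]
        commutant_apply[OF A] commutant_apply[OF B])

lemma Id_op_in_bicommutant: "Id_op L \<in> commutant L (commutant L X)"
proof (rule commutantI)
  fix x f assume "x \<in> commutant L X"
  then have x: "bdd_op L x" by (rule commutant_bdd_op)
  \<comment> \<open>For f outside \<open>l2\<close> both sides are 0 by the convention on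
    representatives.\<close>
  show "Id_op L (x f) = x (Id_op L f)"
    by (simp add: Id_op_def bdd_op_l2[OF x] bdd_op_outside[OF x] bdd_op_0[OF x])
qed (rule bdd_op_Id)

subsection \<open>Left and right multiplication operators\<close>

lemma Ts_apply:
  assumes "f \<in> l2 L" "v \<in> Wgrp L"
  shows "Ts L q s f v = f (gmul s v) + (if v \<noteq> [] \<and> hd v = s then complex_of_real (hp q) * f v else 0)"
  using assms by (simp add: Ts_def length_gmul_less_iff)

text \<open>T_s is a permutation of coordinates plus p times the projection onto words starting with
  s, whence the bound 1 + |p|.\<close>

lemma bdd_op_Ts:
  assumes "s < L"
  shows "bdd_op L (Ts L q s)"
proof -
  define g where "g f = (\<lambda>v. if v \<in> Wgrp L then f (gmul s v) else (0::complex))" for f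
  define k where "k f = (\<lambda>v. complex_of_real (hp q) * restr {v. v \<noteq> [] \<and> hd v = s} f v)" for f
  have inj: "inj_on (gmul s) (Wgrp L)"
    by (rule inj_on_inverseI[of _ "gmul s"]) (rule gmul_gmul)
  have g: "g f \<in> l2 L" "l2norm (g f) \<le> l2norm f" if "f \<in> l2 L" for f
    unfolding g_def by (rule l2_reindex[OF that inj])+
  have k: "k f \<in> l2 L" "l2norm (k f) \<le> \<bar>hp q\<bar> * l2norm f" if "f \<in> l2 L" for f
  proof -
    have r: "restr {v. v \<noteq> [] \<and> hd v = s} f \<in> l2 L" "l2norm (restr {v. v \<noteq> [] \<and> hd v = s} f) \<le> l2norm f"
      by (rule l2_dominated[OF that]; simp add: restr_def)+
    show "k f \<in> l2 L" unfolding k_def by (rule l2_scale(1)[OF r(1)])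
    show "l2norm (k f) \<le> \<bar>hp q\<bar> * l2norm f"
      using l2_scale(2)[OF r(1), of "complex_of_real (hp q)"] mult_left_mono[OF r(2), of "\<bar>hp q\<bar>"]
      unfolding k_def by simp
  qed
  have eq: "Ts L q s f = g f + k f" if "f \<in> l2 L" for f
    using that by (auto simp: fun_eq_iff Ts_def length_gmul_less_iff g_def k_def restr_def l2_outside)
  show ?thesis
  proof (rule bdd_opI[where C = "1 + \<bar>hp q\<bar>"])
    fix f assume f: "f \<in> l2 L"
    show "Ts L q s f \<in> l2 L" using g(1)[OF f] k(1)[OF f] by (simp add: eq[OF f] l2_add)
    show "l2norm (Ts L q s f) \<le> (1 + \<bar>hp q\<bar>) * l2norm f"
      using g[OF f] k[OF f] l2_add(2)[of "g f" L "k f"] by (simp add: eq[OF f] algebra_simps)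
    show "Ts L q s (\<lambda>v. c * f v) = (\<lambda>v. c * Ts L q s f v)" for c
      using f by (auto simp: Ts_def l2_scale algebra_simps)
    show "Ts L q s (f + g) = Ts L q s f + Ts L q s g" if "g \<in> l2 L" for g
      using f that by (auto simp: Ts_def l2_add algebra_simps fun_eq_iff)
  qed (simp add: Ts_def)
qed

text \<open>Inversion in the group reverses words, so conjugating left multiplication by reversal gives
  right multiplication.\<close>

definition flip :: "(nat list \<Rightarrow> complex) \<Rightarrow> nat list \<Rightarrow> complex" where
  "flip f v = f (rev v)"

definition Rs :: "nat \<Rightarrow> real \<Rightarrow> nat \<Rightarrow> (nat list \<Rightarrow> complex) \<Rightarrow> (nat list \<Rightarrow> complex)" where
  "Rs L q s f = flip (Ts L q s (flip f))"

lemma flip_flip [simp]: "flip (flip f) = f"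
  by (simp add: flip_def fun_eq_iff)

lemma flip_l2: assumes "f \<in> l2 L" shows "flip f \<in> l2 L" "l2norm (flip f) \<le> l2norm f"
proof -
  have "flip f = (\<lambda>v. if v \<in> Wgrp L then f (rev v) else 0)"
    using l2_outside[OF assms] by (auto simp: flip_def fun_eq_iff)
  then show "flip f \<in> l2 L" "l2norm (flip f) \<le> l2norm f"
    using l2_reindex[OF assms, of rev] by (auto simp: inj_on_def)
qed

lemma flip_l2_iff: "flip f \<in> l2 L \<longleftrightarrow> f \<in> l2 L"
  using flip_l2(1)[of f L] flip_l2(1)[of "flip f" L] by auto

lemma bdd_op_Rs:
  assumes "s < L"
  shows "bdd_op L (Rs L q s)"
proof -
  note T = bdd_op_Ts[OF assms, of q]
  obtain C where C: "0 \<le> C" "\<And>f. f \<in> l2 L \<Longrightarrow> l2norm (Ts L q s f) \<le> C * l2norm f"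
    using T by (elim bdd_op_bound) auto
  have plus: "flip (f + g) = flip f + flip g" for f g by (simp add: flip_def fun_eq_iff)
  have scale: "flip (\<lambda>v. c * f v) = (\<lambda>v. c * flip f v)" for c f by (simp add: flip_def fun_eq_iff)
  show ?thesis
  proof (rule bdd_opI[where C = C])
    fix f assume f: "f \<in> l2 L"
    note f' = flip_l2[OF f]
    show "Rs L q s f \<in> l2 L" by (simp add: Rs_def flip_l2 bdd_op_l2[OF T])
    show "l2norm (Rs L q s f) \<le> C * l2norm f"
      using flip_l2(2)[OF bdd_op_l2[OF T], of "flip f"] C(2)[OF f'(1)] mult_left_mono[OF f'(2) C(1)]
      by (simp add: Rs_def)
    show "Rs L q s (\<lambda>v. c * f v) = (\<lambda>v. c * Rs L q s f v)" for c
      using f' by (simp add: Rs_def scale bdd_op_scale[OF T])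
    show "Rs L q s (f + g) = Rs L q s f + Rs L q s g" if "g \<in> l2 L" for g
      using f' flip_l2[OF that] by (simp add: Rs_def plus bdd_op_add[OF T])
  next
    fix f assume "f \<notin> l2 L"
    then show "Rs L q s f = 0" by (simp add: Rs_def flip_l2_iff bdd_op_outside[OF T]) (simp add: flip_def fun_eq_iff)
  qed
qed

lemma Rs_apply:
  assumes "f \<in> l2 L" "v \<in> Wgrp L"
  shows "Rs L q s f v = f (gmulr s v) + (if v \<noteq> [] \<and> last v = s then complex_of_real (hp q) * f v else 0)"
  using Ts_apply[of "flip f" L "rev v" q s] assms
  by (auto simp: Rs_def flip_def gmulr_def flip_l2 hd_rev)

lemma gmulr_in_Wgrp: "v \<in> Wgrp L \<Longrightarrow> s < L \<Longrightarrow> gmulr s v \<in> Wgrp L"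
  by (simp add: gmulr_def gmul_in_Wgrp)

text \<open>Associativity of the deformed multiplication. In words of length at least 2, multiplying
  at one end leaves the letter at the other end alone, so the p terms match as well; lengths 0 and 1
  are checked directly.\<close>

lemma Ts_Rs_commute:
  assumes "s < L" "t < L"
  shows "Ts L q s (Rs L q t f) = Rs L q t (Ts L q s f)"
proof (cases "f \<in> l2 L")
  case True
  note T = bdd_op_Ts[OF assms(1), of q] and R = bdd_op_Rs[OF assms(2), of q]
  show ?thesis
  proof (rule ext)
    fix v
    show "Ts L q s (Rs L q t f) v = Rs L q t (Ts L q s f) v"
    proof (cases "v \<in> Wgrp L")
      case v: True
      note app = Ts_apply[OF bdd_op_l2[OF R] v] Rs_apply[OF bdd_op_l2[OF T] v]
        Rs_apply[OF True v] Ts_apply[OF True v]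
        Rs_apply[OF True gmul_in_Wgrp[OF v assms(1)]]
        Ts_apply[OF True gmulr_in_Wgrp[OF v assms(2)]] gmul_gmulr_commute[OF v, of s t]
      show ?thesis
      proof (cases v)
        case Nil
        then show ?thesis unfolding app by auto
      next
        case (Cons a m)
        show ?thesis
        proof (cases m rule: rev_cases)
          case Nil
          with Cons show ?thesis
            using gmulr_snoc[of t "[]" a] unfolding app by (auto simp: gmul_Cons)
        next
          case (snoc k b)
          with Cons have "hd (gmulr t v) = a" "gmulr t v \<noteq> []" "last (gmul s v) = b" "gmul s v \<noteq> []"
            using gmulr_snoc[of t "a # k" b] by (auto simp: gmul_Cons)
          with Cons snoc show ?thesis unfolding app by (auto simp: algebra_simps)
        qed
      qed
    qed (simp add: l2_outside[OF bdd_op_l2[OF T]] l2_outside[OF bdd_op_l2[OF R]])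
  qed
qed (simp add: bdd_op_outside[OF bdd_op_Ts[OF assms(1)]] bdd_op_outside[OF bdd_op_Rs[OF assms(2)]]
       bdd_op_0[OF bdd_op_Ts[OF assms(1)]] bdd_op_0[OF bdd_op_Rs[OF assms(2)]])

text \<open>T_w is a product of the T_s along w, so the previous lemma applies letter by letter.
  Consequently all of VN_q commutes with right multiplications.\<close>

lemma Rs_in_commutant:
  assumes "t < L"
  shows "Rs L q t \<in> commutant L (Tw L q ` Wgrp L)"
proof (rule commutantI)
  note R = bdd_op_Rs[OF assms, of q]
  fix x f assume "x \<in> Tw L q ` Wgrp L"
  then obtain w where w: "w \<in> Wgrp L" "x = Tw L q w" by auto
  have "Rs L q t (Tw L q w f) = Tw L q w (Rs L q t f)"
    using w(1)
  proof (induction w)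
    case Nil
    then show ?case by (simp add: Tw_def Id_op_def bdd_op_l2[OF R] bdd_op_outside[OF R] bdd_op_0[OF R])
  next
    case (Cons s w)
    then show ?case
      by (simp add: Tw_def Cons_in_Wgrp_iff Ts_Rs_commute[OF _ assms, symmetric])
  qed
  then show "Rs L q t (x f) = x (Rs L q t f)" using w by simp
qed (rule bdd_op_Rs[OF assms])

section \<open>The element h and the first properties of the radial algebra\<close>

lemma hrad_eq_sum: "hrad L q f = (\<Sum>s<L. Ts L q s f)"
  by (simp add: hrad_def sum_fun_apply)

lemma bdd_op_hrad: "bdd_op L (hrad L q)"
  unfolding hrad_def by (rule bdd_op_sum) (simp add: bdd_op_Ts)

lemma hrad_apply:
  assumes "f \<in> l2 L" "v \<in> Wgrp L"
  shows "hrad L q f v = (\<Sum>s<L. f (gmul s v)) + (if v = [] then 0 else complex_of_real (hp q) * f v)"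
proof -
  have "hd v < L" if "v \<noteq> []" using assms(2) that by (cases v) (auto simp: Cons_in_Wgrp_iff)
  then show ?thesis
    unfolding hrad_eq_sum sum_fun_apply Ts_apply[OF assms]
    by (cases "v = []") (simp_all add: sum.distrib)
qed

lemma sum_Rs_apply:
  assumes "f \<in> l2 L" "v \<in> Wgrp L"
  shows "(\<Sum>s<L. Rs L q s f v) = (\<Sum>s<L. f (gmulr s v)) + (if v = [] then 0 else complex_of_real (hp q) * f v)"
proof -
  have "last v < L" if "v \<noteq> []"
    using assms(2) that last_in_set[of v] by (auto simp: Wgrp_altdef subset_iff)
  then show ?thesis
    unfolding Rs_apply[OF assms]
    by (cases "v = []") (simp_all add: sum.distrib)
qed

text \<open>Commutants reverse inclusions, so it is enough that whatever commutes with all T_w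
  commutes with h, a sum of T_w over one-letter words.\<close>

lemma Brad_subset_VNq: "Brad L q \<subseteq> VNq L q"
  unfolding Brad_def VNq_def
proof (rule commutant_antimono, rule subsetI)
  fix y assume y: "y \<in> commutant L (Tw L q ` Wgrp L)"
  then have b: "bdd_op L y" by (rule commutant_bdd_op)
  have "y (Ts L q s f) = Ts L q s (y f)" if "s < L" for s f
  proof -
    note T = bdd_op_Ts[OF that, of q]
    have "Tw L q [s] = Ts L q s"
      by (auto simp: fun_eq_iff Tw_def Id_op_def bdd_op_0[OF T] bdd_op_outside[OF T])
    moreover have "[s] \<in> Wgrp L" using that by (simp add: Cons_in_Wgrp_iff)
    ultimately show ?thesis using commutant_apply[OF y] by (metis imageI)
  qed
  then have "y (hrad L q f) = hrad L q (y f)" for f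
    unfolding hrad_eq_sum by (subst bdd_op_sum_apply(1)[OF b]) (auto intro: bdd_op_l2[OF bdd_op_Ts])
  then show "y \<in> commutant L {hrad L q}"
    by (intro commutantI b) simp
qed

lemma hrad_in_Brad: "hrad L q \<in> Brad L q"
  unfolding Brad_def by (rule bicommutant_superset) (auto simp: bdd_op_hrad)

text \<open>Since h commutes with itself, {h}'' is contained in {h}', with which {h}''
  commutes.\<close>

lemma Brad_commute:
  assumes "a \<in> Brad L q" "b \<in> Brad L q"
  shows "a \<circ> b = b \<circ> a"
proof -
  have "hrad L q \<in> commutant L {hrad L q}" by (rule commutantI) (auto simp: bdd_op_hrad)
  then have "b \<in> commutant L {hrad L q}"
    using assms(2) by (auto simp: Brad_def commutant_def)
  then show ?thesis using assms(1) by (auto simp: Brad_def commutant_def)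
qed

subsection \<open>Operators commuting with right multiplication\<close>

lemma snoc_in_Wgrp_iff: "v @ [s] \<in> Wgrp L \<longleftrightarrow> s < L \<and> v \<in> Wgrp L \<and> (v = [] \<or> last v \<noteq> s)"
  using Cons_in_Wgrp_iff[of s "rev v" L] rev_in_Wgrp_iff[of "v @ [s]" L] by (auto simp: hd_rev)

lemma gmulr_gmulr: "v \<in> Wgrp L \<Longrightarrow> gmulr s (gmulr s v) = v"
  by (simp add: gmulr_def gmul_gmul[of _ L])

lemma gmul_eq_Nil_iff: "gmul s v = [] \<longleftrightarrow> v = [s]"
  by (cases v) (auto simp: gmul_Cons)

lemma gmulr_eq_Nil_iff: "gmulr s v = [] \<longleftrightarrow> v = [s]"
  by (simp add: gmulr_def gmul_eq_Nil_iff)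

lemma gmulr_eq_snoc:
  assumes "v @ [s] \<in> Wgrp L"
  shows "gmulr s v = v @ [s]"
proof -
  have "v = [] \<or> last v \<noteq> s" using assms by (simp add: snoc_in_Wgrp_iff)
  then show ?thesis by (cases v rule: rev_cases) (auto simp: gmulr_snoc)
qed

text \<open>Right multiplication by s lengthens w, so no p term appears. Iteration reaches every
  basis vector from \<open>delta []\<close>.\<close>

lemma Rs_delta:
  assumes "w @ [s] \<in> Wgrp L"
  shows "Rs L q s (delta w) = delta (w @ [s])"
proof (rule ext)
  fix v
  have w: "w \<in> Wgrp L" "s < L" "w = [] \<or> last w \<noteq> s" using assms by (auto simp: snoc_in_Wgrp_iff)
  show "Rs L q s (delta w) v = delta (w @ [s]) v"
  proof (cases "v \<in> Wgrp L")
    case True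
    have "gmulr s v = w \<longleftrightarrow> v = w @ [s]"
      using gmulr_gmulr[OF True, of s] gmulr_gmulr[OF w(1), of s] gmulr_eq_snoc[OF assms] by auto
    then show ?thesis
      using w by (auto simp: Rs_apply[OF delta_l2[OF w(1)] True] delta_def)
  next
    case False
    then show ?thesis
      using l2_outside[OF bdd_op_l2[OF bdd_op_Rs[OF w(2)]] False] assms by (auto simp: delta_def)
  qed
qed

section \<open>Matrix entries and convergence\<close>

locale right_equivariant =
  fixes L :: nat and q :: real and D :: "(nat list \<Rightarrow> complex) \<Rightarrow> nat list \<Rightarrow> complex"
  assumes bdd: "bdd_op L D"
    and Rs: "s < L \<Longrightarrow> D (Rs L q s f) = Rs L q s (D f)"
begin

text \<open>Formally D is left multiplication by \<open>D (delta [])\<close>. The last letter of u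
  is moved across to w by \<open>Rs\<close>, and reducedness of the resulting word removes the p
  term.\<close>

lemma entry:
  assumes "w @ rev u \<in> Wgrp L"
  shows "D (delta u) w = D (delta []) (w @ rev u)"
  using assms
proof (induction u arbitrary: w rule: rev_induct)
  case (snoc s u)
  have ws: "w @ [s] \<in> Wgrp L" using append_in_WgrpD(1)[of "w @ [s]" "rev u" L] snoc.prems by simp
  then have w: "w \<in> Wgrp L" "s < L" "w = [] \<or> last w \<noteq> s" by (auto simp: snoc_in_Wgrp_iff)
  have us: "u @ [s] \<in> Wgrp L"
    using append_in_WgrpD(2)[of w "s # rev u" L] snoc.prems rev_in_Wgrp_iff[of "u @ [s]" L] by simp
  have "D (delta (u @ [s])) w = Rs L q s (D (delta u)) w"
    using Rs[OF w(2), of "delta u"] by (simp add: Rs_delta[OF us])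
  also have "\<dots> = D (delta u) (w @ [s])"
    using w by (auto simp: Rs_apply[OF bdd_op_l2[OF bdd] w(1)] gmulr_eq_snoc[OF ws])
  also have "\<dots> = D (delta []) (w @ rev (u @ [s]))"
    using snoc.IH[of "w @ [s]"] snoc.prems by simp
  finally show ?case .
qed simp

text \<open>For w = [] the word in \<open>entry\<close> is always reduced, so the row at [] is the
  reversed column at []. Cauchy-Schwarz bounds it by the norm of that column instead of the operator
  norm.\<close>

lemma apply_Nil_le:
  assumes "z \<in> l2 L"
  shows "cmod (D z []) \<le> l2norm (D (delta [])) * l2norm z"
  using bdd assms
proof (rule bdd_op_cmod_le)
  fix F assume F: "finite F" "F \<subseteq> Wgrp L"
  let ?\<zeta> = "flip (D (delta []))"
  have \<zeta>: "?\<zeta> \<in> l2 L" "l2norm ?\<zeta> \<le> l2norm (D (delta []))"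
    by (rule flip_l2[OF bdd_op_l2[OF bdd]])+
  have "D (restr F z) [] = (\<Sum>u\<in>F. z u * ?\<zeta> u)"
    unfolding bdd_op_restr_apply[OF bdd F]
  proof (rule sum.cong)
    fix u assume "u \<in> F"
    then have "D (delta u) [] = D (delta []) ([] @ rev u)" using F(2) by (intro entry) auto
    then show "z u * D (delta u) [] = z u * ?\<zeta> u" by (simp add: flip_def)
  qed simp
  also have "cmod \<dots> \<le> (\<Sum>u\<in>F. \<bar>cmod (?\<zeta> u)\<bar> * \<bar>cmod (z u)\<bar>)"
    by (rule order_trans[OF norm_sum]) (simp add: norm_mult mult.commute)
  also have "\<dots> \<le> L2_set (\<lambda>u. cmod (?\<zeta> u)) F * L2_set (\<lambda>u. cmod (z u)) F"
    by (rule L2_set_mult_ineq)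
  also have "\<dots> \<le> l2norm (D (delta [])) * l2norm z"
    using L2_le_l2norm[OF \<zeta>(1) F(1)] L2_le_l2norm[OF assms F(1)] \<zeta>(2)
    by (intro mult_mono) (auto simp: l2norm_nonneg)
  finally show "cmod (D (restr F z) []) \<le> l2norm (D (delta [])) * l2norm z" .
qed

end

text \<open>Only one column is controlled, not the operator norms of the \<open>D n\<close>. This
  yields norm convergence on basis vectors, but on general vectors only convergence of each
  coordinate.\<close>

locale right_equivariant_null =
  fixes L :: nat and q :: real and D :: "nat \<Rightarrow> (nat list \<Rightarrow> complex) \<Rightarrow> nat list \<Rightarrow> complex"
  assumes equi: "right_equivariant L q (D n)"
    and null: "(\<lambda>n. l2norm (D n (delta []))) \<longlonglongrightarrow> 0"
begin

lemma delta_null: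
  assumes "u \<in> Wgrp L"
  shows "(\<lambda>n. l2norm (D n (delta u))) \<longlonglongrightarrow> 0"
  using assms
proof (induction u rule: rev_induct)
  case Nil
  show ?case by (rule null)
next
  case (snoc s u)
  then have u: "u \<in> Wgrp L" "s < L" by (auto simp: snoc_in_Wgrp_iff)
  obtain C where C: "\<And>f. f \<in> l2 L \<Longrightarrow> l2norm (Rs L q s f) \<le> C * l2norm f"
    using bdd_op_Rs[OF u(2), of q] by (elim bdd_op_bound) auto
  have le: "l2norm (D n (delta (u @ [s]))) \<le> C * l2norm (D n (delta u))" for n
    using C[OF bdd_op_l2[OF right_equivariant.bdd[OF equi]]] right_equivariant.Rs[OF equi u(2), of n "delta u"]
    by (simp add: Rs_delta[OF snoc.prems])
  have lim: "(\<lambda>n. C * l2norm (D n (delta u))) \<longlonglongrightarrow> 0"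
    using tendsto_mult_left[OF snoc.IH[OF u(1)], of C] by simp
  show ?case
    by (rule tendsto_sandwich[OF _ _ tendsto_const lim]) (simp_all add: l2norm_nonneg le)
qed

text \<open>For reduced w s, coordinate w s of D z is coordinate w of R_s (D z) = D (R_s z). So z
  varies in the induction, which ends at \<open>apply_Nil_le\<close>.\<close>

lemma pointwise_null:
  assumes "w \<in> Wgrp L" "z \<in> l2 L"
  shows "(\<lambda>n. D n z w) \<longlonglongrightarrow> 0"
  using assms
proof (induction w arbitrary: z rule: rev_induct)
  case Nil
  have "(\<lambda>n. l2norm (D n (delta [])) * l2norm z) \<longlonglongrightarrow> 0"
    using tendsto_mult_right[OF null, of "l2norm z"] by simp
  then show ?case
    by (rule Lim_null_comparison[rotated])
       (simp add: right_equivariant.apply_Nil_le[OF equi Nil.prems(2)])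
next
  case (snoc s w)
  then have w: "w \<in> Wgrp L" "s < L" "w = [] \<or> last w \<noteq> s" by (auto simp: snoc_in_Wgrp_iff)
  have "D n z (w @ [s]) = D n (Rs L q s z) w" for n
    using w right_equivariant.Rs[OF equi w(2), of n z]
    by (auto simp: Rs_apply[OF bdd_op_l2[OF right_equivariant.bdd[OF equi]] w(1)]
          gmulr_eq_snoc[OF snoc.prems(1)])
  then show ?case
    using snoc.IH[OF w(1) bdd_op_l2[OF bdd_op_Rs[OF w(2)]], of q z] by simp
qed

end

subsection \<open>Spherical elements of the radial algebra\<close>

definition sphere_fun :: "nat \<Rightarrow> nat \<Rightarrow> nat list \<Rightarrow> complex" where
  "sphere_fun L n v = (if v \<in> Wgrp L \<and> length v = n then 1 else 0)"

lemma sphere_fun_0: "sphere_fun L 0 = delta []"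
  by (auto simp: sphere_fun_def delta_def fun_eq_iff)

lemma sphere_fun_l2: "sphere_fun L n \<in> l2 L"
proof -
  have "sphere_fun L n = restr {w \<in> Wgrp L. length w = n} (\<lambda>_. 1)"
    by (simp add: sphere_fun_def restr_def fun_eq_iff)
  also have "\<dots> = (\<Sum>u | u \<in> Wgrp L \<and> length u = n. (\<lambda>v. 1 * delta u v))"
    by (rule restr_finite_eq_sum[OF finite_Wgrp_length])
  also have "\<dots> \<in> l2 L"
    by (rule bdd_op_sum_apply(2)[OF bdd_op_Id]) (simp add: delta_l2)
  finally show ?thesis .
qed

lemma hrad_delta_Nil: "hrad L q (delta []) = sphere_fun L 1"
proof (rule ext)
  fix v
  have *: "delta [] \<in> l2 L" by (simp add: delta_l2)
  show "hrad L q (delta []) v = sphere_fun L 1 v"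
  proof (cases "v \<in> Wgrp L")
    case True
    show ?thesis
    proof (cases "v = []")
      case False
      with True show ?thesis
        unfolding hrad_apply[OF * True] sum_gmul[OF True False]
        by (cases v) (auto simp: delta_def sphere_fun_def)
    qed (simp add: hrad_apply[OF *] delta_def sphere_fun_def)
  qed (simp add: sphere_fun_def l2_outside[OF bdd_op_l2[OF bdd_op_hrad]])
qed

text \<open>The coefficient of the sphere of radius n counts the longer neighbours of a word: L for
  the empty word, L - 1 for any other.\<close>

lemma hrad_sphere_fun_Suc:
  "hrad L q (sphere_fun L (Suc n)) v =
    sphere_fun L (Suc (Suc n)) v + (if n = 0 then of_nat L else of_nat (L - 1)) * sphere_fun L n v
      + complex_of_real (hp q) * sphere_fun L (Suc n) v"
proof (cases "v \<in> Wgrp L")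
  case True
  show ?thesis
  proof (cases v)
    case Nil
    have "(\<Sum>s<L. sphere_fun L (Suc n) [s]) = (if n = 0 then of_nat L else 0)"
      by (auto simp: sphere_fun_def Cons_in_Wgrp_iff)
    with Nil show ?thesis
      unfolding hrad_apply[OF sphere_fun_l2 True] by (auto simp: sphere_fun_def)
  next
    case (Cons a m)
    have am: "a < L" "m \<in> Wgrp L" "v \<noteq> []" using True Cons by (auto simp: Cons_in_Wgrp_iff)
    have "(\<Sum>s\<in>{..<L} - {a}. sphere_fun L (Suc n) (s # v)) =
        (\<Sum>s\<in>{..<L} - {a}. sphere_fun L n v)"
      using True Cons by (intro sum.cong) (auto simp: sphere_fun_def Cons_in_Wgrp_iff)
    then have "(\<Sum>s<L. sphere_fun L (Suc n) (gmul s v)) =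
        sphere_fun L (Suc n) m + of_nat (L - 1) * sphere_fun L n v"
      using sum_gmul[OF True am(3), of "sphere_fun L (Suc n)"] am(1) Cons by simp
    moreover have "sphere_fun L (Suc n) m = sphere_fun L (Suc (Suc n)) v"
      using True am Cons by (simp add: sphere_fun_def)
    moreover have "sphere_fun L n v = 0" if "n = 0"
      using that am(3) by (simp add: sphere_fun_def)
    ultimately show ?thesis
      unfolding hrad_apply[OF sphere_fun_l2 True] using am(3) by (cases "n = 0") simp_all
  qed
qed (simp add: sphere_fun_def l2_outside[OF bdd_op_l2[OF bdd_op_hrad]])

lemma Brad_sphere_fun: "\<exists>a\<in>Brad L q. a (delta []) = sphere_fun L n"
proof (induction n rule: induct_nat_012)
  case 0
  show ?case
    using Id_op_in_bicommutant[of L "{hrad L q}"]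
    by (auto simp: Brad_def Id_op_def sphere_fun_0 delta_l2 intro!: bexI[of _ "Id_op L"])
next
  case 1
  show ?case using hrad_in_Brad hrad_delta_Nil by (metis One_nat_def)
next
  case (ge2 n)
  then obtain a b where a: "a \<in> Brad L q" "a (delta []) = sphere_fun L n"
    and b: "b \<in> Brad L q" "b (delta []) = sphere_fun L (Suc n)" by auto
  let ?c = "if n = 0 then of_nat L else of_nat (L - 1) :: complex"
  \<comment> \<open>The three-term recursion solved for the sphere of radius n + 2.\<close>
  let ?d = "(hrad L q \<circ> b) + ((\<lambda>f v. (- ?c) * a f v) + (\<lambda>f v. (- complex_of_real (hp q)) * b f v))"
  have "?d \<in> Brad L q"
    using a b hrad_in_Brad[of L q] unfolding Brad_def
    by (intro bicommutant_plus bicommutant_scaled commutant_comp)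
  moreover have "?d (delta []) = sphere_fun L (Suc (Suc n))"
    by (rule ext) (simp add: a b hrad_sphere_fun_Suc)
  ultimately show ?case by blast
qed

lemma Brad_truncation:
  assumes c: "\<And>v. v \<in> Wgrp L \<Longrightarrow> \<xi> v = c (length v)"
  shows "\<exists>a\<in>Brad L q. \<forall>v\<in>Wgrp L. a (delta []) v = restr {v. length v \<le> n} \<xi> v"
proof (induction n)
  case 0
  obtain a where "a \<in> Brad L q" "a (delta []) = sphere_fun L 0" using Brad_sphere_fun by blast
  then show ?case
    using bicommutant_scaled[of a L "{hrad L q}" "c 0"] c unfolding Brad_def[symmetric]
    by (intro bexI[of _ "\<lambda>f v. c 0 * a f v"]) (auto simp: sphere_fun_def restr_def)
next
  case (Suc n)
  then obtain a where a: "a \<in> Brad L q" "\<forall>v\<in>Wgrp L. a (delta []) v = restr {v. length v \<le> n} \<xi> v"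
    by blast
  obtain b where b: "b \<in> Brad L q" "b (delta []) = sphere_fun L (Suc n)" using Brad_sphere_fun by blast
  let ?d = "a + (\<lambda>f v. c (Suc n) * b f v)"
  have "?d \<in> Brad L q"
    using a b unfolding Brad_def by (intro bicommutant_plus bicommutant_scaled)
  then show ?case
    using a b c by (intro bexI[of _ ?d]) (auto simp: sphere_fun_def restr_def le_Suc_eq)
qed

section \<open>Elements of VN_q that commute with h\<close>

lemma VNq_right_equivariant: "x \<in> VNq L q \<Longrightarrow> right_equivariant L q x"
  unfolding VNq_def
  by unfold_locales (auto intro: commutant_bdd_op commutant_apply Rs_in_commutant)

lemma tail_tendsto_0:
  assumes "f \<in> l2 L"
  shows "(\<lambda>n. l2norm (restr (- {v. length v \<le> n}) f)) \<longlonglongrightarrow> 0"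
    and "(\<lambda>n. L2_set (\<lambda>w. norm (f w)) {w \<in> Wgrp L. length w = n}) \<longlonglongrightarrow> 0"
proof -
  show tail: "(\<lambda>n. l2norm (restr (- {v. length v \<le> n}) f)) \<longlonglongrightarrow> 0"
  proof (rule LIMSEQ_I)
    fix e :: real assume "0 < e"
    then obtain F where F: "finite F" "\<And>E. F \<subseteq> E \<Longrightarrow> l2norm (restr (- E) f) < e"
      using assms by (elim l2norm_tail_less) auto
    have "F \<subseteq> {v. length v \<le> n}" if "n \<ge> Max (length ` F)" for n
    proof
      fix v assume "v \<in> F"
      with F(1) have "length v \<le> Max (length ` F)" by simp
      with that show "v \<in> {v. length v \<le> n}" by simp
    qed
    then have "norm (l2norm (restr (- {v. length v \<le> n}) f) - 0) < e" if "n \<ge> Max (length ` F)" for n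
      using F(2) that by (simp add: l2norm_nonneg)
    then show "\<exists>no. \<forall>n\<ge>no. norm (l2norm (restr (- {v. length v \<le> n}) f) - 0) < e" by blast
  qed
  \<comment> \<open>The sphere of radius n + 1 lies outside the ball of radius n, whence the index
    shift.\<close>
  have le: "L2_set (\<lambda>w. norm (f w)) {w \<in> Wgrp L. length w = Suc n} \<le> l2norm (restr (- {v. length v \<le> n}) f)"
    for n
  proof -
    have "L2_set (\<lambda>w. norm (f w)) {w \<in> Wgrp L. length w = Suc n} =
          L2_set (\<lambda>w. norm (restr (- {v. length v \<le> n}) f w)) {w \<in> Wgrp L. length w = Suc n}"
      by (rule L2_set_cong) (auto simp: restr_def)
    then show ?thesis using L2_le_l2norm[OF restr_l2[OF assms] finite_Wgrp_length] by simp
  qed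
  have "(\<lambda>n. L2_set (\<lambda>w. norm (f w)) {w \<in> Wgrp L. length w = Suc n}) \<longlonglongrightarrow> 0"
    by (rule tendsto_sandwich[OF _ _ tendsto_const tail]) (simp_all add: L2_set_nonneg le)
  then show "(\<lambda>n. L2_set (\<lambda>w. norm (f w)) {w \<in> Wgrp L. length w = n}) \<longlonglongrightarrow> 0"
    by (rule LIMSEQ_imp_Suc)
qed

text \<open>Left and right multiplication by h agree on \<open>delta []\<close>. Applying x, which
  commutes with h and with each \<open>Rs\<close>, transports this to \<open>x (delta [])\<close>,
  where the p terms cancel.\<close>

lemma commuting_vector_radial:
  assumes "2 \<le> L" "x \<in> VNq L q" "x \<circ> hrad L q = hrad L q \<circ> x"
  shows "radial_commuting L (x (delta []))"
proof
  interpret x: right_equivariant L q x by (rule VNq_right_equivariant[OF assms(2)])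
  let ?\<xi> = "x (delta [])"
  have \<xi>: "?\<xi> \<in> l2 L" by (rule bdd_op_l2[OF x.bdd])
  have d: "delta [] \<in> l2 L" by (simp add: delta_l2)
  fix v assume v: "v \<in> Wgrp L"
  have "hrad L q (delta []) = (\<Sum>s<L. Rs L q s (delta []))"
  proof (rule ext)
    fix w show "hrad L q (delta []) w = (\<Sum>s<L. Rs L q s (delta [])) w"
    proof (cases "w \<in> Wgrp L")
      case True
      have "(\<Sum>s<L. delta [] (gmul s w)) = (\<Sum>s<L. delta [] (gmulr s w))"
        by (simp add: delta_def gmul_eq_Nil_iff gmulr_eq_Nil_iff)
      then show ?thesis
        by (simp add: hrad_apply[OF d True] sum_fun_apply sum_Rs_apply[OF d True])
    qed (simp add: sum_fun_apply l2_outside[OF bdd_op_l2[OF bdd_op_hrad]]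
           l2_outside[OF bdd_op_l2[OF bdd_op_Rs]])
  qed
  moreover have "hrad L q ?\<xi> = x (hrad L q (delta []))" using assms(3) by (metis o_apply)
  ultimately have "hrad L q ?\<xi> = x (\<Sum>s<L. Rs L q s (delta []))" by simp
  also have "\<dots> = (\<Sum>s<L. x (Rs L q s (delta [])))"
    by (rule bdd_op_sum_apply(1)[OF x.bdd]) (simp add: bdd_op_l2[OF bdd_op_Rs])
  also have "\<dots> = (\<Sum>s<L. Rs L q s ?\<xi>)" by (simp add: x.Rs)
  finally have "hrad L q ?\<xi> = (\<Sum>s<L. Rs L q s ?\<xi>)" .
  then show "(\<Sum>s<L. ?\<xi> (gmul s v)) = (\<Sum>s<L. ?\<xi> (gmulr s v))"
    using hrad_apply[OF \<xi> v, of q] sum_Rs_apply[OF \<xi> v, of q] by (simp add: sum_fun_apply)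
next
  interpret x: right_equivariant L q x by (rule VNq_right_equivariant[OF assms(2)])
  show "(\<lambda>n. L2_set (\<lambda>w. norm (x (delta []) w)) {w \<in> Wgrp L. length w = n}) \<longlonglongrightarrow> 0"
    by (rule tail_tendsto_0(2)[OF bdd_op_l2[OF x.bdd]])
qed (rule assms(1))

lemma commuting_in_Brad:
  assumes "2 \<le> L" "x \<in> VNq L q" "x \<circ> hrad L q = hrad L q \<circ> x"
  shows "x \<in> Brad L q"
proof -
  interpret x: right_equivariant L q x by (rule VNq_right_equivariant[OF assms(2)])
  interpret radial_commuting L "x (delta [])" by (rule commuting_vector_radial[OF assms])
  define \<xi> where "\<xi> = x (delta [])"
  have \<xi>: "\<xi> \<in> l2 L" unfolding \<xi>_def by (rule bdd_op_l2[OF x.bdd])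
  \<comment> \<open>The radial profile; by \<open>radial\<close> the value is the same for every
    word of length n.\<close>
  define c where "c n = \<xi> (SOME w. w \<in> Wgrp L \<and> length w = n)" for n
  have "\<xi> v = c (length v)" if "v \<in> Wgrp L" for v
  proof -
    have "(SOME w. w \<in> Wgrp L \<and> length w = length v) \<in> Wgrp L \<and>
        length (SOME w. w \<in> Wgrp L \<and> length w = length v) = length v"
      by (rule someI_ex) (use that in auto)
    with that show ?thesis unfolding c_def \<xi>_def by (intro radial) simp_all
  qed
  then have "\<exists>a\<in>Brad L q. \<forall>v\<in>Wgrp L. a (delta []) v = restr {v. length v \<le> n} \<xi> v" for n
    by (rule Brad_truncation)
  then obtain A where A: "\<And>n. A n \<in> Brad L q"
      "\<And>n v. v \<in> Wgrp L \<Longrightarrow> A n (delta []) v = restr {v. length v \<le> n} \<xi> v"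
    by metis
  have A_equi: "right_equivariant L q (A n)" for n
    using A(1) Brad_subset_VNq VNq_right_equivariant by blast
  note A_bdd = right_equivariant.bdd[OF A_equi]
  \<comment> \<open>This is A n - x, whose column at [] is minus the tail of \<xi> beyond length
    n.\<close>
  define D where "D n = A n + (\<lambda>f v. (- 1) * x f v)" for n
  interpret D: right_equivariant_null L q D
  proof
    fix n
    show "bdd_op L (D n)" unfolding D_def by (intro bdd_op_plus bdd_op_scaled A_bdd x.bdd)
    show "D n (Rs L q s f) = Rs L q s (D n f)" if "s < L" for s f
    proof -
      note R = bdd_op_Rs[OF that, of q]
      have "D n f = A n f + (\<lambda>v. (- 1) * x f v)" by (simp add: D_def fun_eq_iff)
      then have "Rs L q s (D n f) = Rs L q s (A n f + (\<lambda>v. (- 1) * x f v))" by (simp only:)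
      also have "\<dots> = Rs L q s (A n f) + Rs L q s (\<lambda>v. (- 1) * x f v)"
        by (rule bdd_op_add[OF R bdd_op_l2[OF A_bdd] l2_scale(1)[OF bdd_op_l2[OF x.bdd]]])
      also have "Rs L q s (\<lambda>v. (- 1) * x f v) = (\<lambda>v. (- 1) * Rs L q s (x f) v)"
        by (rule bdd_op_scale[OF R bdd_op_l2[OF x.bdd]])
      finally have "Rs L q s (D n f) = Rs L q s (A n f) + (\<lambda>v. (- 1) * Rs L q s (x f) v)" .
      moreover have "D n (Rs L q s f) = Rs L q s (A n f) + (\<lambda>v. (- 1) * Rs L q s (x f) v)"
        using right_equivariant.Rs[OF A_equi that, of n f] x.Rs[OF that, of f]
        by (simp add: D_def fun_eq_iff)
      ultimately show ?thesis by (simp only:)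
    qed
  next
    have "D n (delta []) = (\<lambda>v. (- 1) * restr (- {v. length v \<le> n}) \<xi> v)" for n
    proof (rule ext)
      fix v show "D n (delta []) v = (- 1) * restr (- {v. length v \<le> n}) \<xi> v"
        using A(2)[of v n] l2_outside[OF \<xi>, of v] l2_outside[OF bdd_op_l2[OF A_bdd], of v n]
        by (cases "v \<in> Wgrp L") (auto simp: D_def \<xi>_def restr_def)
    qed
    then have "l2norm (D n (delta [])) \<le> l2norm (restr (- {v. length v \<le> n}) \<xi>)" for n
      using l2_scale(2)[OF restr_l2[OF \<xi>], of "- 1"] by simp
    then show "(\<lambda>n. l2norm (D n (delta []))) \<longlonglongrightarrow> 0"
      by (intro tendsto_sandwich[OF _ _ tendsto_const tail_tendsto_0(1)[OF \<xi>]])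
         (simp_all add: l2norm_nonneg)
  qed
  show ?thesis
    unfolding Brad_def
  proof (rule commutantI)
    fix y f assume y: "y \<in> commutant L {hrad L q}"
    then have y_bdd: "bdd_op L y" by (rule commutant_bdd_op)
    obtain C where C: "\<And>f. f \<in> l2 L \<Longrightarrow> l2norm (y f) \<le> C * l2norm f"
      using y_bdd by (elim bdd_op_bound) auto
    have "x \<circ> y = y \<circ> x"
    proof (rule bdd_op_eqI)
      fix u assume u: "u \<in> Wgrp L"
      show "(x \<circ> y) (delta u) = (y \<circ> x) (delta u)"
      proof (rule ext)
        fix w
        show "(x \<circ> y) (delta u) w = (y \<circ> x) (delta u) w"
        proof (cases "w \<in> Wgrp L")
          case True
          \<comment> \<open>The vector \<open>y (delta u)\<close> may have infinite support, so
            coordinatewise convergence is used here.\<close>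
          have 1: "(\<lambda>n. D n (y (delta u)) w) \<longlonglongrightarrow> 0"
            by (rule D.pointwise_null[OF True bdd_op_l2[OF y_bdd]])
          have Dn: "D n (delta u) \<in> l2 L" for n
            by (rule bdd_op_l2[OF right_equivariant.bdd[OF D.equi]])
          have le: "cmod (y (D n (delta u)) w) \<le> C * l2norm (D n (delta u))" for n
            using norm_le_l2norm[OF bdd_op_l2[OF y_bdd]] C[OF Dn] by (rule order_trans)
          have lim: "(\<lambda>n. C * l2norm (D n (delta u))) \<longlonglongrightarrow> 0"
            using tendsto_mult_left[OF D.delta_null[OF u], of C] by simp
          \<comment> \<open>On \<open>delta u\<close> itself \<open>D n\<close> tends to 0 in norm,
            and boundedness of y preserves this.\<close>
          have 2: "(\<lambda>n. y (D n (delta u)) w) \<longlonglongrightarrow> 0"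
            by (rule Lim_null_comparison[OF always_eventually lim]) (intro allI le)
          \<comment> \<open>As A n commutes with y, its contribution cancels and the difference is
            independent of n.\<close>
          have "D n (y (delta u)) w - y (D n (delta u)) w = y (x (delta u)) w - x (y (delta u)) w" for n
          proof -
            have "D n (delta u) = A n (delta u) + (\<lambda>v. (- 1) * x (delta u) v)"
              by (simp add: D_def fun_eq_iff)
            then have "y (D n (delta u)) = y (A n (delta u) + (\<lambda>v. (- 1) * x (delta u) v))"
              by (simp only:)
            also have "\<dots> = y (A n (delta u)) + y (\<lambda>v. (- 1) * x (delta u) v)"
              by (rule bdd_op_add[OF y_bdd bdd_op_l2[OF A_bdd] l2_scale(1)[OF bdd_op_l2[OF x.bdd]]])
            also have "y (A n (delta u)) = A n (y (delta u))"
              using A(1)[of n] y unfolding Brad_def by (rule commutant_apply[symmetric])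
            also have "y (\<lambda>v. (- 1) * x (delta u) v) = (\<lambda>v. (- 1) * y (x (delta u)) v)"
              by (rule bdd_op_scale[OF y_bdd bdd_op_l2[OF x.bdd]])
            finally have "y (D n (delta u)) = A n (y (delta u)) + (\<lambda>v. (- 1) * y (x (delta u)) v)" .
            then show ?thesis by (simp only:) (simp add: D_def)
          qed
          with tendsto_diff[OF 1 2] have "(\<lambda>n::nat. y (x (delta u)) w - x (y (delta u)) w) \<longlonglongrightarrow> 0"
            by simp
          then have "y (x (delta u)) w - x (y (delta u)) w = 0"
            by (simp only: LIMSEQ_const_iff)
          then show ?thesis by simp
        qed (simp add: l2_outside[OF bdd_op_l2[OF x.bdd]] l2_outside[OF bdd_op_l2[OF y_bdd]])
      qed
    qed (intro bdd_op_comp x.bdd y_bdd)+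
    then show "x (y f) = y (x f)" by (simp add: fun_eq_iff)
  qed (rule x.bdd)
qed

theorem theorem2p5:
  fixes L :: nat and q :: real
  assumes "L \<ge> 3" and "0 < q" and "q \<le> 1"
  shows "masa (Brad L q) (VNq L q)"
  unfolding masa_def
proof (intro conjI ballI impI)
  fix x assume "x \<in> VNq L q" "\<forall>b\<in>Brad L q. x \<circ> b = b \<circ> x"
  \<comment> \<open>Among the elements of the radial algebra, commutation with h alone
    suffices.\<close>
  with assms(1) show "x \<in> Brad L q"
    by (intro commuting_in_Brad) (simp_all add: hrad_in_Brad)
qed (fact Brad_subset_VNq, rule Brad_commute)

end
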